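(* The following problem is undecidable: given $d$, a VAS $\mathbf{A}\subseteq\mathbb{Z}^d$, a configuration $\mathbf{x}\in\mathbb{N}^d$, and a downward-closed set $D$ of transitions of $\mathbf{A}$ (given finitely), decide whether the set $I=\downarrow\mathbf{x}\times D^*\times\downarrow\mathbf{x}=\{(\mathbf{u},w,\mathbf{v})\in\mathrm{PreRuns}_{\mathbf{A}}\mid \mathbf{u}\le\mathbf{x},\ \mathbf{v}\le\mathbf{x},\ w\in D^*\}$ is in the adherence of $\mathrm{Runs}_{\mathbf{A}}(\mathbf{x},\mathbf{x})$. In particular, the adherence membership problem for prerun ideals (given $\mathbf{A}$, $\mathbf{x},\mathbf{y}\in\mathbb{N}^d$ and an ideal $I$ of $\mathrm{PreRuns}_{\mathbf{A}}$, decide whether $I$ is in the adherence of $\mathrm{Runs}_{\mathbf{A}}(\mathbf{x},\mathbf{y})$) is undecidable.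
   Context: A VAS of dimension $d$ is a finite set $\mathbf{A}\subseteq\mathbb{Z}^d$; configurations are vectors of $\mathbb{N}^d$, ordered componentwise. A transition is a triple $(\mathbf{u},\mathbf{a},\mathbf{v})\in\mathbb{N}^d\times\mathbf{A}\times\mathbb{N}^d$ with $\mathbf{v}=\mathbf{u}+\mathbf{a}$; triples are ordered by $(\mathbf{u},\mathbf{a},\mathbf{v})\le(\mathbf{u}',\mathbf{a}',\mathbf{v}')$ iff $\mathbf{u}\le\mathbf{u}'$, $\mathbf{a}=\mathbf{a}'$, $\mathbf{v}\le\mathbf{v}'$. A prerun is a triple $(\mathbf{u},w,\mathbf{v})$ with $\mathbf{u},\mathbf{v}\in\mathbb{N}^d$ and $w$ a finite word over $\mathbb{N}^d\times\mathbf{A}\times\mathbb{N}^d$; $\mathrm{PreRuns}_{\mathbf{A}}$ is the set of preruns. A prerun $(\mathbf{u},w,\mathbf{v})$ with $w=(\mathbf{u}_1,\mathbf{a}_1,\mathbf{v}_1)\cdots(\mathbf{u}_k,\mathbf{a}_k,\mathbf{v}_k)$ is a run if every letter is a transition and either $k=0$ and $\mathbf{u}=\mathbf{v}$, or $k>0$, $\mathbf{u}=\mathbf{u}_1$, $\mathbf{v}=\mathbf{v}_k$, $\mathbf{u}_{j+1}=\mathbf{v}_j$ for $1\le j<k$. $\mathrm{Runs}_{\mathbf{A}}(\mathbf{x},\mathbf{y})$ denotes the runs from $\mathbf{x}$ to $\mathbf{y}$. Preruns are ordered by $(\mathbf{u},w,\mathbf{v})\trianglelefteq(\mathbf{u}',w',\mathbf{v}')$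 iff $\mathbf{u}\le\mathbf{u}'$, $\mathbf{v}\le\mathbf{v}'$ and $w$ embeds in $w'$ (i.e. $w=t_1\cdots t_k$, $w'=w'_0t'_1w'_1\cdots t'_kw'_k$ with $t_j\le t'_j$). For a set $\Delta$ of preruns, $\downarrow\Delta$ is its downward closure in $\mathrm{PreRuns}_{\mathbf{A}}$. A set $\Delta$ is directed if any two elements have a common upper bound in $\Delta$; an ideal is a nonempty downward-closed directed set. A set $I$ of preruns is in the adherence of a set $S$ of preruns if there exists a directed $\Delta\subseteq S$ with $\downarrow\Delta=I$.
   Formalization: D is taken as the downward closure, among all triples of N^d × A × N^d, of a set of transitions; if D contained only genuine transitions, I would be downward-closed only when D is empty or {(0,0,0)}, and the problem would be trivially decidable. *)

theory Defs
  imports Main "HOL-Library.Sublist" "HOL-Library.Nat_Bijection" "HOL-Library.Extended_Nat"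
begin

section \<open>Computability\<close>

text \<open>Partial recursive functions. \<open>rec_eval f xs y\<close>: \<open>f\<close> is defined on \<open>xs\<close> with value \<open>y\<close>.\<close>

datatype recf =
    Zero
  | Succ
  | Proj nat
  | Comp recf "recf list"
  | PrimRec recf recf
  | Mu recf

inductive rec_eval :: "recf \<Rightarrow> nat list \<Rightarrow> nat \<Rightarrow> bool" where
  eval_Zero: "rec_eval Zero xs 0"
| eval_Succ: "rec_eval Succ [x] (Suc x)"
| eval_Proj: "i < length xs \<Longrightarrow> rec_eval (Proj i) xs (xs ! i)"
| eval_Comp: "list_all2 (\<lambda>g y. rec_eval g xs y) gs ys \<Longrightarrow> rec_eval f ys z
    \<Longrightarrow> rec_eval (Comp f gs) xs z"
| eval_PrimRec_0: "rec_eval f xs y \<Longrightarrow> rec_eval (PrimRec f g) (0 # xs) y"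
| eval_PrimRec_Suc: "rec_eval (PrimRec f g) (n # xs) y \<Longrightarrow> rec_eval g (n # y # xs) z
    \<Longrightarrow> rec_eval (PrimRec f g) (Suc n # xs) z"
| eval_Mu: "rec_eval f (n # xs) 0 \<Longrightarrow> (\<And>k. k < n \<Longrightarrow> \<exists>m. rec_eval f (k # xs) (Suc m))
    \<Longrightarrow> rec_eval (Mu f) xs n"

inductive_cases ZeroE: "rec_eval Zero xs z"
inductive_cases SuccE: "rec_eval Succ xs z"
inductive_cases ProjE: "rec_eval (Proj i) xs z"
inductive_cases CompE: "rec_eval (Comp f gs) xs z"
inductive_cases PrimRec0E: "rec_eval (PrimRec f g) (0 # xs) z"
inductive_cases PrimRecSucE: "rec_eval (PrimRec f g) (Suc n # xs) z"
inductive_cases MuE: "rec_eval (Mu f) xs z"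

lemma rec_eval_deterministic: "rec_eval f xs y \<Longrightarrow> rec_eval f xs z \<Longrightarrow> y = z"
proof (induction arbitrary: z rule: rec_eval.induct)
  case (eval_Zero xs)
  then show ?case by (rule ZeroE) simp
next
  case (eval_Succ x)
  then show ?case by (rule SuccE) simp
next
  case (eval_Proj i xs)
  from eval_Proj.prems show ?case by (rule ProjE) simp
next
  case (eval_Comp xs gs ys f z z')
  from eval_Comp.prems obtain ys' where ys': "list_all2 (\<lambda>g y. rec_eval g xs y) gs ys'"
      and f: "rec_eval f ys' z'"
    by (rule CompE)
  from eval_Comp.IH(1) ys' have "ys = ys'"
    unfolding list_all2_conv_all_nth by (intro nth_equalityI) auto
  with f eval_Comp.IH(2) show ?case by blast
next
  case (eval_PrimRec_0 f xs y g)
  from eval_PrimRec_0.prems show ?case by (rule PrimRec0E) (rule eval_PrimRec_0.IH)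
next
  case (eval_PrimRec_Suc f g n xs y z z')
  from eval_PrimRec_Suc.prems obtain y' where "rec_eval (PrimRec f g) (n # xs) y'"
      "rec_eval g (n # y' # xs) z'"
    by (rule PrimRecSucE)
  with eval_PrimRec_Suc.IH show ?case by blast
next
  case (eval_Mu f n xs z)
  from eval_Mu.prems have z: "rec_eval f (z # xs) 0"
      "\<forall>k<z. \<exists>m. rec_eval f (k # xs) (Suc m)"
    by (auto elim!: MuE)
  show ?case
  proof (rule linorder_cases[of n z])
    assume "n < z"
    then obtain m where "rec_eval f (n # xs) (Suc m)" using z(2) by blast
    then have "0 = Suc m" by (rule eval_Mu.IH(1))
    then show ?thesis by simp
  next
    assume "z < n"
    then obtain m where "\<forall>y. rec_eval f (z # xs) y \<longrightarrow> Suc m = y"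
      using eval_Mu.IH(2) by blast
    with z(1) show ?thesis by auto
  qed
qed

text \<open>
  A decision problem consists of an encoding of its instances, the set of valid instances and the
  yes-instances. An algorithm has to halt with the right answer on every valid instance; its
  behaviour on other inputs is irrelevant.
\<close>

definition decidable_problem :: "('i \<Rightarrow> nat) \<Rightarrow> 'i set \<Rightarrow> ('i \<Rightarrow> bool) \<Rightarrow> bool" where
  "decidable_problem enc V P \<longleftrightarrow> (\<exists>f. \<forall>i\<in>V. rec_eval f [enc i] (if P i then 1 else 0))"

lemma decidable_problem_subset:
  "decidable_problem enc V P \<Longrightarrow> W \<subseteq> V \<Longrightarrow> decidable_problem enc W P"
  unfolding decidable_problem_def by blast


section \<open>Directed sets, ideals and adherence\<close>

definition down_in :: "('a \<Rightarrow> 'a \<Rightarrow> bool) \<Rightarrow> 'a set \<Rightarrow> 'a set \<Rightarrow> 'a set" where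
  "down_in le X S = {r \<in> X. \<exists>s\<in>S. le r s}"

definition directed_set :: "('a \<Rightarrow> 'a \<Rightarrow> bool) \<Rightarrow> 'a set \<Rightarrow> bool" where
  "directed_set le S \<longleftrightarrow> (\<forall>r\<in>S. \<forall>s\<in>S. \<exists>t\<in>S. le r t \<and> le s t)"

definition down_closed_in :: "('a \<Rightarrow> 'a \<Rightarrow> bool) \<Rightarrow> 'a set \<Rightarrow> 'a set \<Rightarrow> bool" where
  "down_closed_in le X S \<longleftrightarrow> S \<subseteq> X \<and> (\<forall>s\<in>S. \<forall>r\<in>X. le r s \<longrightarrow> r \<in> S)"

definition ideal_in :: "('a \<Rightarrow> 'a \<Rightarrow> bool) \<Rightarrow> 'a set \<Rightarrow> 'a set \<Rightarrow> bool" where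
  "ideal_in le X I \<longleftrightarrow> I \<noteq> {} \<and> down_closed_in le X I \<and> directed_set le I"

definition in_adherence :: "('a \<Rightarrow> 'a \<Rightarrow> bool) \<Rightarrow> 'a set \<Rightarrow> 'a set \<Rightarrow> 'a set \<Rightarrow> bool" where
  "in_adherence le X I S \<longleftrightarrow> (\<exists>\<Delta>\<subseteq>S. directed_set le \<Delta> \<and> down_in le X \<Delta> = I)"


section \<open>Vector addition systems\<close>

type_synonym config = "nat list"
type_synonym action = "int list"
type_synonym triple = "config \<times> action \<times> config"
type_synonym prerun = "config \<times> triple list \<times> config"

definition vas :: "nat \<Rightarrow> action set \<Rightarrow> bool" where
  "vas d A \<longleftrightarrow> finite A \<and> (\<forall>a\<in>A. length a = d)"

definition configs :: "nat \<Rightarrow> config set" where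
  "configs d = {u. length u = d}"

definition vec_le :: "config \<Rightarrow> config \<Rightarrow> bool" where
  "vec_le u v \<longleftrightarrow> list_all2 (\<le>) u v"

definition triples :: "nat \<Rightarrow> action set \<Rightarrow> triple set" where
  "triples d A = configs d \<times> A \<times> configs d"

definition transitions :: "nat \<Rightarrow> action set \<Rightarrow> triple set" where
  "transitions d A = {(u, a, v) \<in> triples d A. \<forall>i<d. int (v ! i) = int (u ! i) + a ! i}"

fun triple_le :: "triple \<Rightarrow> triple \<Rightarrow> bool" where
  "triple_le (u, a, v) (u', a', v') \<longleftrightarrow> vec_le u u' \<and> a = a' \<and> vec_le v v'"

definition preruns :: "nat \<Rightarrow> action set \<Rightarrow> prerun set" where
  "preruns d A = configs d \<times> lists (triples d A) \<times> configs d"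

fun prerun_le :: "prerun \<Rightarrow> prerun \<Rightarrow> bool" where
  "prerun_le (u, w, v) (u', w', v') \<longleftrightarrow> vec_le u u' \<and> vec_le v v' \<and> list_emb triple_le w w'"

fun is_run :: "nat \<Rightarrow> action set \<Rightarrow> prerun \<Rightarrow> bool" where
  "is_run d A (u, w, v) \<longleftrightarrow>
     (u, w, v) \<in> preruns d A \<and> set w \<subseteq> transitions d A \<and>
     (w = [] \<and> u = v \<or>
      w \<noteq> [] \<and> u = fst (hd w) \<and> v = snd (snd (last w)) \<and>
      (\<forall>j. Suc j < length w \<longrightarrow> fst (w ! Suc j) = snd (snd (w ! j))))"

definition runs :: "nat \<Rightarrow> action set \<Rightarrow> config \<Rightarrow> config \<Rightarrow> prerun set" where
  "runs d A x y = {(u, w, v). is_run d A (u, w, v) \<and> u = x \<and> v = y}"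

definition star_preruns :: "nat \<Rightarrow> action set \<Rightarrow> config \<Rightarrow> triple set \<Rightarrow> prerun set" where
  "star_preruns d A x D = {(u, w, v) \<in> preruns d A. vec_le u x \<and> vec_le v x \<and> w \<in> lists D}"

text \<open>
  The downward closure in the definition of adherence is taken among all preruns, whose letters are
  arbitrary triples. Hence a \<open>downward-closed set of transitions\<close> \<open>D\<close> has to be closed in the ordered
  set \<open>triples d A\<close>: it is the downward closure there of a set of transitions. If instead \<open>D\<close>
  contained transitions only, then \<open>star_preruns d A x D\<close> would never be downward closed, except in
  the trivial cases \<open>D = {}\<close> and \<open>D = {(0, 0, 0)}\<close> (lemma \<open>transitions_only_degenerate\<close>).
\<close>

definition down_closed_transition_set :: "nat \<Rightarrow> action set \<Rightarrow> triple set \<Rightarrow> bool" where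
  "down_closed_transition_set d A D \<longleftrightarrow>
     (\<exists>T\<subseteq>transitions d A. D = down_in triple_le (triples d A) T)"

lemma vec_le_refl: "vec_le u u"
  by (simp add: vec_le_def list_all2_refl)

lemma vec_le_trans: "vec_le u v \<Longrightarrow> vec_le v w \<Longrightarrow> vec_le u w"
  unfolding vec_le_def by (rule list_all2_trans[of "(\<le>)" "(\<le>)" "(\<le>)"]) auto

lemma down_closed_transition_set_imp_down_closed:
  assumes "down_closed_transition_set d A D"
  shows "down_closed_in triple_le (triples d A) D"
proof -
  have "triple_le r t" if "triple_le r s" "triple_le s t" for r s t
    using that by (cases r; cases s; cases t) (auto intro: vec_le_trans)
  with assms show ?thesis
    unfolding down_closed_transition_set_def down_closed_in_def down_in_def by blast
qed

lemma transitions_only_degenerate: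
  assumes D: "D \<subseteq> transitions d A" and t: "(u, a, v) \<in> D"
    and nz: "u \<noteq> replicate d 0 \<or> v \<noteq> replicate d 0"
    and x: "length x = d"
  shows "\<not> in_adherence prerun_le (preruns d A) (star_preruns d A x D) S"
proof
  assume "in_adherence prerun_le (preruns d A) (star_preruns d A x D) S"
  then obtain \<Delta> where \<Delta>: "down_in prerun_le (preruns d A) \<Delta> = star_preruns d A x D"
    unfolding in_adherence_def by blast
  let ?z = "replicate d 0 :: nat list"
  have len: "length u = d" "length v = d" "a \<in> A"
    using D t by (auto simp: transitions_def triples_def configs_def)
  have uv: "\<forall>i<d. int (v ! i) = int (u ! i) + a ! i"
    using D t by (auto simp: transitions_def)
  have "(x, [(u, a, v)], x) \<in> star_preruns d A x D"
    using t len x by (auto simp: star_preruns_def preruns_def configs_def triples_def vec_le_refl)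
  with \<Delta> obtain s where s: "s \<in> \<Delta>" "prerun_le (x, [(u, a, v)], x) s"
    unfolding down_in_def by blast
  have emb: "list_emb triple_le [(u', a, v')] w"
    if "list_emb triple_le [(u, a, v)] w" "vec_le u' u" "vec_le v' v" for u' v' w
  proof -
    from that(1) obtain ys t zs where w: "w = ys @ t # zs" and t: "triple_le (u, a, v) t"
      by (auto dest!: list_emb_ConsD simp del: triple_le.simps)
    from t that(2,3) have "triple_le (u', a, v') t"
      by (cases t) (auto intro: vec_le_trans)
    then show ?thesis
      unfolding w by (intro list_emb_append2 list_emb_Cons2 list_emb_Nil)
  qed
  have mem: "(u', a, v') \<in> transitions d A"
    if "vec_le u' u" "vec_le v' v" for u' v'
  proof -
    have l: "length u' = d" "length v' = d"
      using that len by (auto simp: vec_le_def dest: list_all2_lengthD)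
    obtain p w q where spq: "s = (p, w, q)" by (cases s)
    have "prerun_le (x, [(u', a, v')], x) s"
      using s(2) emb[OF _ that] spq by auto
    moreover have "(x, [(u', a, v')], x) \<in> preruns d A"
      using l x len by (auto simp: preruns_def configs_def triples_def)
    ultimately have "(x, [(u', a, v')], x) \<in> star_preruns d A x D"
      using s(1) \<Delta> unfolding down_in_def by blast
    then show ?thesis using D by (auto simp: star_preruns_def)
  qed
  have z: "vec_le ?z u" "vec_le ?z v"
    using len by (auto simp: vec_le_def list_all2_conv_all_nth)
  from mem[OF z(1) z(2)] have a0: "\<forall>i<d. a ! i = 0" by (auto simp: transitions_def)
  from mem[OF z(1) vec_le_refl] a0 have "\<forall>i<d. v ! i = 0" by (auto simp: transitions_def)
  moreover from this uv a0 have "\<forall>i<d. u ! i = 0" by auto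
  ultimately show False using nz len by (auto simp: list_eq_iff_nth_eq)
qed


section \<open>Finite presentations of downward-closed sets and ideals\<close>

text \<open>
  The ideals of \<open>configs d\<close> are the sets of configurations below a vector of extended naturals. The
  downward-closed subsets of \<open>triples d A\<close> are the finite unions of products of such ideals with
  singleton actions. The ideals of the words over \<open>triples d A\<close> are the finite products of atoms
  \<open>J \<union> {\<epsilon>}\<close>, with \<open>J\<close> an ideal of triples, and \<open>D\<^sup>*\<close>, with \<open>D\<close> a downward-closed set of triples.
\<close>

type_synonym ovec = "enat list"
type_synonym otriple = "ovec \<times> action \<times> ovec"

datatype atom = Opt otriple | Star "otriple list"

type_synonym ideal_rep = "ovec \<times> atom list \<times> ovec"

definition below :: "ovec \<Rightarrow> config set" where
  "below m = {u. list_all2 (\<lambda>k n. enat k \<le> n) u m}"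

fun otriple_set :: "otriple \<Rightarrow> triple set" where
  "otriple_set (m, a, n) = below m \<times> {a} \<times> below n"

definition otriples_set :: "otriple list \<Rightarrow> triple set" where
  "otriples_set ts = (\<Union>t\<in>set ts. otriple_set t)"

fun atom_words :: "atom \<Rightarrow> triple list set" where
  "atom_words (Opt t) = {[]} \<union> {[s] | s. s \<in> otriple_set t}"
| "atom_words (Star ts) = lists (otriples_set ts)"

fun atoms_words :: "atom list \<Rightarrow> triple list set" where
  "atoms_words [] = {[]}"
| "atoms_words (p # ps) = {w @ w' | w w'. w \<in> atom_words p \<and> w' \<in> atoms_words ps}"

fun ideal_of :: "ideal_rep \<Rightarrow> prerun set" where
  "ideal_of (m, ps, n) = below m \<times> atoms_words ps \<times> below n"

fun wf_otriple :: "nat \<Rightarrow> action set \<Rightarrow> otriple \<Rightarrow> bool" where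
  "wf_otriple d A (m, a, n) \<longleftrightarrow> length m = d \<and> a \<in> A \<and> length n = d"

fun wf_atom :: "nat \<Rightarrow> action set \<Rightarrow> atom \<Rightarrow> bool" where
  "wf_atom d A (Opt t) \<longleftrightarrow> wf_otriple d A t"
| "wf_atom d A (Star ts) \<longleftrightarrow> (\<forall>t\<in>set ts. wf_otriple d A t)"

fun wf_ideal_rep :: "nat \<Rightarrow> action set \<Rightarrow> ideal_rep \<Rightarrow> bool" where
  "wf_ideal_rep d A (m, ps, n) \<longleftrightarrow>
     length m = d \<and> (\<forall>p\<in>set ps. wf_atom d A p) \<and> length n = d"


section \<open>Encoding of the finite data\<close>

definition enat_encode :: "enat \<Rightarrow> nat" where
  "enat_encode k = (case k of enat n \<Rightarrow> Suc n | \<infinity> \<Rightarrow> 0)"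

definition config_encode :: "config \<Rightarrow> nat" where
  "config_encode = list_encode"

definition action_encode :: "action \<Rightarrow> nat" where
  "action_encode a = list_encode (map int_encode a)"

definition actions_encode :: "action list \<Rightarrow> nat" where
  "actions_encode as = list_encode (map action_encode as)"

definition ovec_encode :: "ovec \<Rightarrow> nat" where
  "ovec_encode m = list_encode (map enat_encode m)"

fun otriple_encode :: "otriple \<Rightarrow> nat" where
  "otriple_encode (m, a, n) =
     prod_encode (ovec_encode m, prod_encode (action_encode a, ovec_encode n))"

definition otriples_encode :: "otriple list \<Rightarrow> nat" where
  "otriples_encode ts = list_encode (map otriple_encode ts)"

fun atom_encode :: "atom \<Rightarrow> nat" where
  "atom_encode (Opt t) = sum_encode (Inl (otriple_encode t))"
| "atom_encode (Star ts) = sum_encode (Inr (otriples_encode ts))"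

fun ideal_rep_encode :: "ideal_rep \<Rightarrow> nat" where
  "ideal_rep_encode (m, ps, n) =
     prod_encode (ovec_encode m, prod_encode (list_encode (map atom_encode ps), ovec_encode n))"


section \<open>The two decision problems\<close>

text \<open>Dimension, actions of the VAS, configuration \<open>x\<close>, and a presentation of \<open>D\<close>.\<close>

type_synonym star_instance = "nat \<times> action list \<times> config \<times> otriple list"

definition star_instances :: "star_instance set" where
  "star_instances = {(d, as, x, ts). vas d (set as) \<and> x \<in> configs d \<and>
     (\<forall>t\<in>set ts. wf_otriple d (set as) t) \<and>
     down_closed_transition_set d (set as) (otriples_set ts)}"

fun star_instance_encode :: "star_instance \<Rightarrow> nat" where
  "star_instance_encode (d, as, x, ts) =
     prod_encode (d, prod_encode (actions_encode as,
       prod_encode (config_encode x, otriples_encode ts)))"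

fun star_in_adherence :: "star_instance \<Rightarrow> bool" where
  "star_in_adherence (d, as, x, ts) \<longleftrightarrow>
     in_adherence prerun_le (preruns d (set as))
       (star_preruns d (set as) x (otriples_set ts)) (runs d (set as) x x)"

text \<open>Dimension, actions of the VAS, configurations \<open>x\<close> and \<open>y\<close>, and a presentation of the ideal.\<close>

type_synonym ideal_instance = "nat \<times> action list \<times> config \<times> config \<times> ideal_rep"

definition ideal_instances :: "ideal_instance set" where
  "ideal_instances = {(d, as, x, y, J). vas d (set as) \<and> x \<in> configs d \<and> y \<in> configs d \<and>
     wf_ideal_rep d (set as) J \<and> ideal_in prerun_le (preruns d (set as)) (ideal_of J)}"

fun ideal_instance_encode :: "ideal_instance \<Rightarrow> nat" where
  "ideal_instance_encode (d, as, x, y, J) =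
     prod_encode (d, prod_encode (actions_encode as,
       prod_encode (config_encode x, prod_encode (config_encode y, ideal_rep_encode J))))"

fun ideal_in_adherence :: "ideal_instance \<Rightarrow> bool" where
  "ideal_in_adherence (d, as, x, y, J) \<longleftrightarrow>
     in_adherence prerun_le (preruns d (set as)) (ideal_of J) (runs d (set as) x y)"


text \<open>The encodings are injective.\<close>

lemma inj_enat_encode: "inj enat_encode"
  by (rule injI) (auto simp: enat_encode_def split: enat.splits)

lemma inj_list_map_encode: "inj f \<Longrightarrow> inj (\<lambda>xs. list_encode (map f xs))"
  by (rule injI) (auto simp: list_encode_eq inj_map_eq_map)

lemma inj_action_encode: "inj action_encode"
  unfolding action_encode_def[abs_def] by (intro inj_list_map_encode inj_int_encode)

lemma inj_actions_encode: "inj actions_encode"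
  unfolding actions_encode_def[abs_def] by (intro inj_list_map_encode inj_action_encode)

lemma inj_ovec_encode: "inj ovec_encode"
  unfolding ovec_encode_def[abs_def] by (intro inj_list_map_encode inj_enat_encode)

lemma inj_otriple_encode: "inj otriple_encode"
  by (rule injI) (auto simp: prod_encode_eq inj_eq[OF inj_ovec_encode] inj_eq[OF inj_action_encode])

lemma inj_otriples_encode: "inj otriples_encode"
  unfolding otriples_encode_def[abs_def] by (intro inj_list_map_encode inj_otriple_encode)

lemma inj_atom_encode: "inj atom_encode"
proof (rule injI)
  fix p q assume "atom_encode p = atom_encode q"
  then show "p = q"
    by (cases p; cases q)
      (simp_all add: sum_encode_eq inj_eq[OF inj_otriple_encode] inj_eq[OF inj_otriples_encode])
qed

lemma inj_ideal_rep_encode: "inj ideal_rep_encode"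
  by (rule injI) (auto simp: prod_encode_eq inj_eq[OF inj_ovec_encode]
    inj_eq[OF inj_list_map_encode[OF inj_atom_encode]])

lemma inj_star_instance_encode: "inj star_instance_encode"
  by (rule injI) (auto simp: prod_encode_eq inj_eq[OF inj_actions_encode] config_encode_def
    list_encode_eq inj_eq[OF inj_otriples_encode])

lemma inj_ideal_instance_encode: "inj ideal_instance_encode"
  by (rule injI) (auto simp: prod_encode_eq inj_eq[OF inj_actions_encode] config_encode_def
    list_encode_eq inj_eq[OF inj_ideal_rep_encode] simp del: ideal_rep_encode.simps)

end

theory Submission
  imports Defs
begin

text \<open>
  Words embed letter by letter and loops on \<open>x\<close> can be concatenated, so \<open>\<down>x \<times> D\<^sup>* \<times> \<down>x\<close> is in the
  adherence of the runs from \<open>x\<close> to \<open>x\<close> iff every triple of \<open>D\<close> lies below a transition of some loop on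
  \<open>x\<close> all of whose transitions are in \<open>D\<close>. Since \<open>D\<close> may bound a component by 0, such loops can test
  counters for zero, hence simulate a counter machine. Every letter of \<open>D\<close> must be covered at
  arbitrarily large values of its unbounded components. To this end the machine is extended by a
  control state that can be entered only after termination and from which every configuration is
  reachable, while every configuration can be erased back to \<open>x\<close> at any time: then all of \<open>D\<close> is covered
  iff the machine terminates.

  If a recursive function \<open>f\<close> decided the problem, compile into such a machine the function that builds
  the code of an instance from its parts and terminates iff \<open>f\<close> answers 0 on it. The first action of the
  VAS loads the input into the registers; choosing as input the codes of the remaining parts of this
  very VAS yields a contradiction.
\<close>

section \<open>Counter programs for recursive functions\<close>

type_synonym store = "nat \<Rightarrow> nat"

text \<open>Programs are nondeterministic: \<open>Loop\<close> may stop after any number of rounds,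
  \<open>Dec\<close> blocks at 0 and \<open>Test0\<close> at a positive value. Blocked branches
  leave no trace in \<open>sem\<close>, so an undefined function value becomes an empty
  image.\<close>

datatype prog = Skip | Inc nat | Dec nat | Test0 nat | Seq prog prog | Loop prog

fun sem :: "prog \<Rightarrow> store rel" where
  "sem Skip = Id"
| "sem (Inc r) = {(s, t). t = s(r := Suc (s r))}"
| "sem (Dec r) = {(s, t). 0 < s r \<and> t = s(r := s r - 1)}"
| "sem (Test0 r) = {(s, t). s r = 0 \<and> t = s}"
| "sem (Seq p q) = sem p O sem q"
| "sem (Loop p) = (sem p)\<^sup>*"

lemma sem_Seq: "(s, t) \<in> sem (Seq p q) \<longleftrightarrow> (\<exists>u. (s, u) \<in> sem p \<and> (u, t) \<in> sem q)"
  by auto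

section \<open>Basic counter programs\<close>

definition fail :: prog where
  "fail = Seq (Inc 0) (Test0 0)"

text \<open>If \<open>p\<close> preserves register \<open>i\<close>, the final test discards all
  branches that leave the loop early: the number of rounds is the initial value of
  \<open>i\<close>.\<close>

definition while_pos :: "nat \<Rightarrow> prog \<Rightarrow> prog" where
  "while_pos i p = Seq (Loop (Seq (Dec i) p)) (Test0 i)"

definition clear :: "nat \<Rightarrow> prog" where
  "clear i = while_pos i Skip"

definition move :: "nat \<Rightarrow> nat \<Rightarrow> prog" where
  "move i j = while_pos i (Inc j)"

text \<open>Register \<open>k\<close> is scratch space: the first loop empties \<open>i\<close> into
  it, the second restores \<open>i\<close> while adding the same amount to \<open>j\<close>.\<close>

definition copy :: "nat \<Rightarrow> nat \<Rightarrow> nat \<Rightarrow> prog" where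
  "copy i j k = Seq (move i k) (while_pos k (Seq (Inc i) (Inc j)))"

fun clears :: "nat \<Rightarrow> nat \<Rightarrow> prog" where
  "clears b 0 = Skip"
| "clears b (Suc n) = Seq (clear b) (clears (Suc b) n)"

lemma sem_fail [simp]: "sem fail = {}"
  by (auto simp: fail_def)

text \<open>\<open>G\<close> is a closed form of the loop, given by its recursion equations. That
  every branch ends in \<open>G s\<close> follows by induction over the rounds; that some branch
  passes the exit test, by induction on the value of register \<open>i\<close>, which
  \<open>F\<close> preserves.\<close>

lemma sem_while_pos_fun:
  assumes p: "\<And>s t. (s, t) \<in> sem p \<longleftrightarrow> t = F s" and F: "\<And>s. F s i = s i"
    and G0: "\<And>s. s i = 0 \<Longrightarrow> G s = s"
    and GS: "\<And>s n. s i = Suc n \<Longrightarrow> G s = G (F (s(i := n)))"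
  shows "(s, t) \<in> sem (while_pos i p) \<longleftrightarrow> t = G s"
proof -
  define R where "R = sem (Seq (Dec i) p)"
  have step: "(s, t) \<in> R \<longleftrightarrow> (\<exists>n. s i = Suc n \<and> t = F (s(i := n)))" for s t
    by (auto simp: R_def p gr0_conv_Suc)
  have "t = G s" if "(s, t) \<in> R\<^sup>*" "t i = 0" for s
    using that by (induction rule: converse_rtrancl_induct) (auto simp: step G0 GS)
  moreover have "(s, G s) \<in> R\<^sup>* \<and> G s i = 0" if "s i = n" for n s
    using that
  proof (induction n arbitrary: s)
    case (Suc n)
    then have "(s, F (s(i := n))) \<in> R" by (auto simp: step)
    with Suc.IH[of "F (s(i := n))"] show ?case
      using GS[of s n] Suc.prems by (auto simp: F intro: converse_rtrancl_into_rtrancl)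
  qed (auto simp: G0)
  ultimately show ?thesis by (auto simp: while_pos_def R_def)
qed

lemma sem_clear [simp]: "(s, t) \<in> sem (clear i) \<longleftrightarrow> t = s(i := 0)"
  unfolding clear_def by (rule sem_while_pos_fun[where F = "\<lambda>s. s"]) auto

lemma sem_move [simp]:
  "i \<noteq> j \<Longrightarrow> (s, t) \<in> sem (move i j) \<longleftrightarrow> t = s(i := 0, j := s j + s i)"
  unfolding move_def by (rule sem_while_pos_fun[where F = "\<lambda>s. s(j := Suc (s j))"]) auto

lemma sem_copy:
  assumes "i \<noteq> j" "i \<noteq> k" "j \<noteq> k" "s k = 0"
  shows "(s, t) \<in> sem (copy i j k) \<longleftrightarrow> t = s(j := s j + s i)"
proof -
  have "(s, t) \<in> sem (while_pos k (Seq (Inc i) (Inc j))) \<longleftrightarrow>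
      t = s(k := 0, i := s i + s k, j := s j + s k)" for s
    using assms(1-3)
    by (intro sem_while_pos_fun[where F = "\<lambda>s. s(i := Suc (s i), j := Suc (s j))"]) auto
  with assms have "(s, t) \<in> sem (copy i j k) \<longleftrightarrow>
      t = s(i := 0, k := s i, k := 0, i := s i, j := s j + s i)"
    by (simp add: copy_def sem_Seq del: sem.simps)
  also have "s(i := 0, k := s i, k := 0, i := s i, j := s j + s i) = s(j := s j + s i)"
    using assms by auto
  finally show ?thesis .
qed

lemma sem_clears:
  "(s, t) \<in> sem (clears b n) \<longleftrightarrow> t = (\<lambda>r. if b \<le> r \<and> r < b + n then 0 else s r)"
proof (induction n arbitrary: b s)
  case (Suc n)
  have "(\<lambda>r. if Suc b \<le> r \<and> r < Suc b + n then 0 else (s(b := 0)) r) =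
      (\<lambda>r. if b \<le> r \<and> r < b + Suc n then 0 else s r)"
    by auto
  then show ?case by (simp add: sem_Seq Suc del: sem.simps)
qed auto

text \<open>
  The result is added to register \<open>out\<close>; the registers from \<open>b\<close> on are scratch space, zero before and
  after. Applications with a wrong number of arguments have no value, hence \<open>fail\<close>.
\<close>

fun compile :: "recf \<Rightarrow> nat list \<Rightarrow> nat \<Rightarrow> nat \<Rightarrow> prog"
  and compiles :: "recf list \<Rightarrow> nat list \<Rightarrow> nat \<Rightarrow> nat \<Rightarrow> prog" where
  "compile Zero rs out b = Skip"
| "compile Succ rs out b = (case rs of [r] \<Rightarrow> Seq (copy r out b) (Inc out) | _ \<Rightarrow> fail)"
| "compile (Proj i) rs out b = (if i < length rs then copy (rs ! i) out b else fail)"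
| "compile (Comp f gs) rs out b =
     Seq (compiles gs rs b (b + length gs))
     (Seq (compile f [b..<b + length gs] out (b + length gs))
       (clears b (length gs)))"
| "compile (PrimRec f g) rs out b = (case rs of [] \<Rightarrow> fail | r # rs' \<Rightarrow>
     Seq (copy r b (b + 4))
     (Seq (compile f rs' (b + 2) (b + 4))
     (Seq (while_pos b
       (Seq (compile g ((b + 1) # (b + 2) # rs') (b + 3) (b + 4))
       (Seq (clear (b + 2))
       (Seq (move (b + 3) (b + 2))
         (Inc (b + 1))))))
     (Seq (move (b + 2) out)
       (clear (b + 1))))))"
| "compile (Mu f) rs out b =
     Seq (compile f (b # rs) (b + 1) (b + 2))
     (Seq (Loop
       (Seq (Dec (b + 1))
       (Seq (clear (b + 1))
       (Seq (Inc b)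
         (compile f (b # rs) (b + 1) (b + 2))))))
     (Seq (Test0 (b + 1))
       (move b out)))"
| "compiles [] rs out b = Skip"
| "compiles (g # gs) rs out b = Seq (compile g rs out b) (compiles gs rs (Suc out) b)"

text \<open>The equivalence includes partiality: where \<open>f\<close> has no value, the program
  has no successful branch. Only \<open>out\<close> changes, so arguments and scratch registers are
  restored and calls can be nested.\<close>

definition computes :: "recf \<Rightarrow> bool" where
  "computes f \<longleftrightarrow> (\<forall>rs out b s t. (\<forall>r\<in>set rs. r < b) \<longrightarrow> out < b \<longrightarrow> out \<notin> set rs \<longrightarrow>
     (\<forall>r\<ge>b. s r = 0) \<longrightarrow>
     ((s, t) \<in> sem (compile f rs out b) \<longleftrightarrow>
      (\<exists>y. rec_eval f (map s rs) y \<and> t = s(out := s out + y))))"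

lemma computesD:
  assumes "computes f" "\<forall>r\<in>set rs. r < b" "out < b" "out \<notin> set rs" "\<forall>r\<ge>b. s r = 0"
  shows "(s, t) \<in> sem (compile f rs out b) \<longleftrightarrow>
      (\<exists>y. rec_eval f (map s rs) y \<and> t = s(out := s out + y))"
  using assms unfolding computes_def by blast

section \<open>Correctness of the compiler\<close>

lemma rec_eval_Zero_iff: "rec_eval Zero xs y \<longleftrightarrow> y = 0"
  by (auto intro: rec_eval.intros elim: ZeroE)

lemma rec_eval_Succ_iff: "rec_eval Succ xs y \<longleftrightarrow> (\<exists>x. xs = [x] \<and> y = Suc x)"
  by (auto intro: rec_eval.intros elim: SuccE)

lemma rec_eval_Proj_iff: "rec_eval (Proj i) xs y \<longleftrightarrow> i < length xs \<and> y = xs ! i"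
  by (auto intro: rec_eval.intros elim: ProjE)

lemma rec_eval_Comp_iff:
  "rec_eval (Comp f gs) xs z \<longleftrightarrow> (\<exists>ys. list_all2 (\<lambda>g y. rec_eval g xs y) gs ys \<and> rec_eval f ys z)"
  by (auto intro: rec_eval.intros elim: CompE)

lemma rec_eval_PrimRec_0_iff: "rec_eval (PrimRec f g) (0 # xs) z \<longleftrightarrow> rec_eval f xs z"
  by (auto intro: rec_eval.intros elim: PrimRec0E)

lemma rec_eval_PrimRec_Suc_iff:
  "rec_eval (PrimRec f g) (Suc n # xs) z \<longleftrightarrow>
   (\<exists>y. rec_eval (PrimRec f g) (n # xs) y \<and> rec_eval g (n # y # xs) z)"
  by (auto intro: rec_eval.intros elim: PrimRecSucE)

lemma not_rec_eval_PrimRec_Nil: "\<not> rec_eval (PrimRec f g) [] z"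
  by (auto elim: rec_eval.cases)

lemma rec_eval_Mu_iff:
  "rec_eval (Mu f) xs n \<longleftrightarrow>
   rec_eval f (n # xs) 0 \<and> (\<forall>k<n. \<exists>m. rec_eval f (k # xs) (Suc m))"
  by (auto intro: rec_eval.intros elim: MuE)

text \<open>The values go to consecutive registers from \<open>out\<close> on. These lie above the
  arguments and below the scratch space, so each call finds the arguments unchanged and its scratch
  registers zero.\<close>

lemma sem_compiles:
  assumes "\<forall>g\<in>set gs. computes g"
    and "\<forall>r\<in>set rs. r < out" "out + length gs \<le> b" "\<forall>r\<ge>out. s r = 0"
  shows "(s, t) \<in> sem (compiles gs rs out b) \<longleftrightarrow>
    (\<exists>ys. list_all2 (\<lambda>g y. rec_eval g (map s rs) y) gs ys \<and>
      t = (\<lambda>r. if out \<le> r \<and> r < out + length gs then ys ! (r - out) else s r))"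
  using assms
proof (induction gs arbitrary: out s)
  case (Cons g gs)
  have g: "(s, u) \<in> sem (compile g rs out b) \<longleftrightarrow>
      (\<exists>y. rec_eval g (map s rs) y \<and> u = s(out := y))" for u
    using Cons.prems by (subst computesD) auto
  have rs: "map (s(out := y)) rs = map s rs" for y
    using Cons.prems(2) by auto
  define upd where "upd y ys = (\<lambda>r. if Suc out \<le> r \<and> r < Suc out + length gs
    then ys ! (r - Suc out) else (s(out := y)) r)" for y ys
  have gs: "(s(out := y), t) \<in> sem (compiles gs rs (Suc out) b) \<longleftrightarrow>
    (\<exists>ys. list_all2 (\<lambda>g y. rec_eval g (map s rs) y) gs ys \<and> t = upd y ys)" for y
    using Cons.prems unfolding upd_def by (subst Cons.IH) (auto simp: rs less_Suc_eq)
  have upd: "(\<lambda>r. if out \<le> r \<and> r < out + length (g # gs) then (y # ys) ! (r - out) else s r) =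
      upd y ys" for y ys
    by (auto simp: upd_def fun_eq_iff nth_Cons' not_less_eq_eq Suc_diff_le)
  have "(s, t) \<in> sem (compiles (g # gs) rs out b) \<longleftrightarrow>
      (\<exists>y ys. rec_eval g (map s rs) y \<and> list_all2 (\<lambda>g y. rec_eval g (map s rs) y) gs ys \<and>
        t = upd y ys)"
    unfolding compiles.simps sem_Seq g using gs by blast
  then show ?case
    unfolding list_all2_Cons1 upd[symmetric] by blast
qed auto

text \<open>The block of registers from \<open>b\<close> on receives the values of
  \<open>gs\<close>, serves as the argument list of \<open>f\<close>, whose scratch space starts
  behind it, and is erased at the end.\<close>

lemma computes_Comp:
  assumes f: "computes f" and gs: "\<forall>g\<in>set gs. computes g"
  shows "computes (Comp f gs)"
  unfolding computes_def
proof (intro allI impI)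
  fix rs :: "nat list" and out b :: nat and s t :: store
  assume *: "\<forall>r\<in>set rs. r < b" "out < b" "out \<notin> set rs" "\<forall>r\<ge>b. s r = 0"
  define n where "n = length gs"
  define upd where "upd ys = (\<lambda>r. if b \<le> r \<and> r < b + n then ys ! (r - b) else s r)" for ys
  have 1: "(s, u) \<in> sem (compiles gs rs b (b + n)) \<longleftrightarrow>
      (\<exists>ys. list_all2 (\<lambda>g y. rec_eval g (map s rs) y) gs ys \<and> u = upd ys)" for u
    using gs * unfolding upd_def n_def by (subst sem_compiles) auto
  have map: "map (upd ys) [b..<b + n] = ys" if "length ys = n" for ys
    using that by (intro nth_equalityI) (auto simp: upd_def)
  have 2: "(upd ys, u) \<in> sem (compile f [b..<b + n] out (b + n)) \<longleftrightarrow>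
      (\<exists>y. rec_eval f ys y \<and> u = (upd ys)(out := s out + y))" if "length ys = n" for ys u
  proof -
    have "\<forall>r\<in>set [b..<b + n]. r < b + n" "out < b + n" "out \<notin> set [b..<b + n]"
      "\<forall>r\<ge>b + n. upd ys r = 0" and out: "upd ys out = s out"
      using * by (auto simp: upd_def)
    from computesD[OF f this(1-4)] show ?thesis by (simp only: map[OF that] out)
  qed
  have 3: "((upd ys)(out := s out + y), t) \<in> sem (clears b n) \<longleftrightarrow> t = s(out := s out + y)" for ys y
  proof -
    have "(\<lambda>r. if b \<le> r \<and> r < b + n then 0 else ((upd ys)(out := s out + y)) r) =
        s(out := s out + y)"
      using * by (auto simp: upd_def)
    then show ?thesis by (simp add: sem_clears)
  qed
  show "(s, t) \<in> sem (compile (Comp f gs) rs out b) \<longleftrightarrow>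
      (\<exists>y. rec_eval (Comp f gs) (map s rs) y \<and> t = s(out := s out + y))"
  proof
    assume "(s, t) \<in> sem (compile (Comp f gs) rs out b)"
    then obtain ys where ys: "list_all2 (\<lambda>g y. rec_eval g (map s rs) y) gs ys"
      and seq: "(upd ys, t) \<in> sem (Seq (compile f [b..<b + n] out (b + n)) (clears b n))"
      by (auto simp: n_def[symmetric] sem_Seq 1 simp del: sem.simps)
    from ys have len: "length ys = n" by (simp add: n_def list_all2_lengthD)
    from seq obtain y where y: "rec_eval f ys y" "t = s(out := s out + y)"
      unfolding sem_Seq 2[OF len] using 3 by (elim exE conjE) simp
    from ys y show "\<exists>y. rec_eval (Comp f gs) (map s rs) y \<and> t = s(out := s out + y)"
      unfolding rec_eval_Comp_iff by blast
  next
    assume "\<exists>y. rec_eval (Comp f gs) (map s rs) y \<and> t = s(out := s out + y)"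
    then obtain ys y where ys: "list_all2 (\<lambda>g y. rec_eval g (map s rs) y) gs ys"
      and y: "rec_eval f ys y" "t = s(out := s out + y)"
      by (auto simp: rec_eval_Comp_iff)
    from ys have len: "length ys = n" by (simp add: n_def list_all2_lengthD)
    have "(s, upd ys) \<in> sem (compiles gs rs b (b + n))" using ys 1 by blast
    moreover have "(upd ys, (upd ys)(out := s out + y)) \<in> sem (compile f [b..<b + n] out (b + n))"
      using y 2[OF len] by blast
    ultimately show "(s, t) \<in> sem (compile (Comp f gs) rs out b)"
      using 3[of ys y] y(2) by (auto simp: n_def[symmetric] sem_Seq simp del: sem.simps)
  qed
qed

text \<open>Register \<open>b\<close> counts the rounds left, \<open>b + 1\<close> the rounds done,
  \<open>b + 2\<close> holds the current value and \<open>b + 3\<close> receives the next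
  one.\<close>

lemma computes_PrimRec:
  assumes f: "computes f" and g: "computes g"
  shows "computes (PrimRec f g)"
  unfolding computes_def
proof (intro allI impI)
  fix rs :: "nat list" and out b :: nat and s t :: store
  assume *: "\<forall>r\<in>set rs. r < b" "out < b" "out \<notin> set rs" "\<forall>r\<ge>b. s r = 0"
  show "(s, t) \<in> sem (compile (PrimRec f g) rs out b) \<longleftrightarrow>
      (\<exists>y. rec_eval (PrimRec f g) (map s rs) y \<and> t = s(out := s out + y))"
  proof (cases rs)
    case Nil
    then show ?thesis by (simp add: not_rec_eval_PrimRec_Nil)
  next
    case (Cons r rs')
    define xs where "xs = map s rs'"
    define st where "st k j a = s(b := k, b + 1 := j, b + 2 := a)" for k j a
    define body where "body = Seq (compile g ((b + 1) # (b + 2) # rs') (b + 3) (b + 4))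
       (Seq (clear (b + 2)) (Seq (move (b + 3) (b + 2)) (Inc (b + 1))))"
    have s0: "s (b + 1) = 0" "s (b + 2) = 0" "s (b + 3) = 0" "s b = 0" using * by auto
    have rs': "map (st k j a) rs' = xs" for k j a
      using *(1) Cons by (auto simp: st_def xs_def)
    have 1: "(s, u) \<in> sem (copy r b (b + 4)) \<longleftrightarrow> u = st (s r) 0 0" for u
      using * Cons s0 by (subst sem_copy) (auto simp: st_def fun_eq_iff)
    have 2: "(st k 0 0, u) \<in> sem (compile f rs' (b + 2) (b + 4)) \<longleftrightarrow>
        (\<exists>y. rec_eval f xs y \<and> u = st k 0 y)" for k u
    proof -
      have "\<forall>r\<in>set rs'. r < b + 4" "b + 2 < b + 4" "b + 2 \<notin> set rs'" "\<forall>r\<ge>b + 4. st k 0 0 r = 0"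
        and st: "st k 0 0 (b + 2) = 0" "(st k 0 0)(b + 2 := y) = st k 0 y" for y
        using * Cons by (auto simp: st_def)
      from computesD[OF f this(1-4)] show ?thesis by (simp only: rs' st) simp
    qed
    have g': "(st k j a, u) \<in> sem (compile g ((b + 1) # (b + 2) # rs') (b + 3) (b + 4)) \<longleftrightarrow>
        (\<exists>y. rec_eval g (j # a # xs) y \<and> u = (st k j a)(b + 3 := y))" for k j a u
    proof -
      have st: "st k j a (b + 1) = j" "st k j a (b + 2) = a" "st k j a (b + 3) = 0"
        using s0 by (auto simp: st_def)
      have "\<forall>r\<in>set ((b + 1) # (b + 2) # rs'). r < b + 4" "b + 3 < b + 4"
        "b + 3 \<notin> set ((b + 1) # (b + 2) # rs')" "\<forall>r\<ge>b + 4. st k j a r = 0"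
        using * Cons by (auto simp: st_def)
      from computesD[OF g this] show ?thesis by (simp only: list.map st rs') simp
    qed
    have upd: "(st k j a)(b + 3 := y, b + 2 := 0, b + 3 := 0, b + 2 := y, b + 1 := Suc j)
        = st k (Suc j) y" for k j a y
      using s0 by (auto simp: st_def fun_eq_iff)
    have body: "(st k j a, u) \<in> sem body \<longleftrightarrow>
        (\<exists>y. rec_eval g (j # a # xs) y \<and> u = st k (Suc j) y)" for k j a u
    proof -
      have "((st k j a)(b + 3 := y), u) \<in> sem (Seq (clear (b + 2))
          (Seq (move (b + 3) (b + 2)) (Inc (b + 1)))) \<longleftrightarrow> u = st k (Suc j) y" for y
        unfolding upd[of k j a, symmetric]
        by (simp add: sem_Seq st_def del: sem.simps(5))
      then show ?thesis unfolding body_def sem_Seq[of _ _ "compile _ _ _ _"] g' by blast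
    qed
    define R where "R = sem (Seq (Dec b) body)"
    have R: "(st k j a, u) \<in> R \<longleftrightarrow>
        (\<exists>y. 0 < k \<and> rec_eval g (j # a # xs) y \<and> u = st (k - 1) (Suc j) y)" for k j a u
    proof -
      have "(st k j a)(b := k - 1) = st (k - 1) j a" by (auto simp: st_def)
      moreover have "st k j a b = k" by (simp add: st_def)
      ultimately show ?thesis by (simp add: R_def sem_Seq body del: sem.simps(5))
    qed
    \<comment> \<open>Indexing the loop by the number \<open>m\<close> of rounds: after
      \<open>m\<close> of them the current value is that of the recursion at
      \<open>m\<close>.\<close>
    have relpow: "(st k 0 a, u) \<in> R ^^ m \<longleftrightarrow>
        m \<le> k \<and> (\<exists>z. rec_eval (PrimRec f g) (m # xs) z \<and> u = st (k - m) m z)"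
      if "rec_eval f xs a" for k a m u
    proof (induction m arbitrary: u)
      case 0
      then show ?case
        using that by (auto simp: rec_eval_PrimRec_0_iff dest: rec_eval_deterministic)
    next
      case (Suc m)
      have "(st k 0 a, u) \<in> R ^^ Suc m \<longleftrightarrow> (\<exists>v. (st k 0 a, v) \<in> R ^^ m \<and> (v, u) \<in> R)"
        by auto
      also have "\<dots> \<longleftrightarrow> Suc m \<le> k \<and>
          (\<exists>z. rec_eval (PrimRec f g) (Suc m # xs) z \<and> u = st (k - Suc m) (Suc m) z)"
        (is "?l \<longleftrightarrow> ?r")
      proof
        assume ?l
        then obtain y where y: "m \<le> k" "rec_eval (PrimRec f g) (m # xs) y" "(st (k - m) m y, u) \<in> R"
          unfolding Suc by blast
        then obtain z where "0 < k - m" "rec_eval g (m # y # xs) z" "u = st (k - m - 1) (Suc m) z"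
          unfolding R by blast
        with y(2) show ?r
          unfolding rec_eval_PrimRec_Suc_iff by (intro conjI exI[of _ z] exI[of _ y]) auto
      next
        assume ?r
        then obtain y z where "Suc m \<le> k" "rec_eval (PrimRec f g) (m # xs) y"
          "rec_eval g (m # y # xs) z" "u = st (k - Suc m) (Suc m) z"
          unfolding rec_eval_PrimRec_Suc_iff by blast
        then show ?l unfolding Suc by (intro exI[of _ "st (k - m) m y"]) (auto simp: R)
      qed
      finally show ?case .
    qed
    \<comment> \<open>Of all numbers of rounds the exit test keeps only
      \<open>m = k\<close>.\<close>
    have 3: "(st k 0 a, u) \<in> sem (while_pos b body) \<longleftrightarrow>
        (\<exists>z. rec_eval (PrimRec f g) (k # xs) z \<and> u = st 0 k z)" if "rec_eval f xs a" for k a u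
    proof -
      have st_b: "st k j z b = k" for k j z by (simp add: st_def)
      have "(st k 0 a, u) \<in> sem (while_pos b body) \<longleftrightarrow> (\<exists>m. (st k 0 a, u) \<in> R ^^ m) \<and> u b = 0"
        unfolding while_pos_def sem_Seq[of _ _ "Loop _"] sem.simps(6) R_def[symmetric] rtrancl_power
        by auto
      also have "\<dots> \<longleftrightarrow> (\<exists>z. rec_eval (PrimRec f g) (k # xs) z \<and> u = st 0 k z)"
        unfolding relpow[OF that] by (auto simp: st_b) (metis diff_self_eq_0 le_refl)
      finally show ?thesis .
    qed
    have 4: "(st 0 j a, t) \<in> sem (Seq (move (b + 2) out) (clear (b + 1))) \<longleftrightarrow>
        t = s(out := s out + a)" for j a
    proof -
      have "(st 0 j a)(b + 2 := 0, out := s out + a, b + 1 := 0) = s(out := s out + a)"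
        using s0 * by (auto simp: st_def fun_eq_iff)
      moreover have "st 0 j a out = s out" "st 0 j a (b + 2) = a" "b + 2 \<noteq> out"
        using * by (auto simp: st_def)
      ultimately show ?thesis by (simp add: sem_Seq del: sem.simps(5))
    qed
    have "(s, t) \<in> sem (compile (PrimRec f g) rs out b) \<longleftrightarrow>
        (\<exists>u v. (st (s r) 0 0, u) \<in> sem (compile f rs' (b + 2) (b + 4)) \<and>
          (u, v) \<in> sem (while_pos b body) \<and>
          (v, t) \<in> sem (Seq (move (b + 2) out) (clear (b + 1))))"
      unfolding Cons compile.simps list.case body_def[symmetric] sem_Seq[of _ _ "copy _ _ _"]
        sem_Seq[of _ _ "compile _ _ _ _"] sem_Seq[of _ _ "while_pos _ _"] 1 by blast
    also have "\<dots> \<longleftrightarrow> (\<exists>a v. rec_eval f xs a \<and> (st (s r) 0 a, v) \<in> sem (while_pos b body) \<and>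
          (v, t) \<in> sem (Seq (move (b + 2) out) (clear (b + 1))))"
      unfolding 2 by blast
    also have "\<dots> \<longleftrightarrow> (\<exists>a z. rec_eval f xs a \<and> rec_eval (PrimRec f g) (s r # xs) z \<and>
          (st 0 (s r) z, t) \<in> sem (Seq (move (b + 2) out) (clear (b + 1))))"
    proof -
      have "rec_eval f xs a \<and> (st (s r) 0 a, v) \<in> sem (while_pos b body) \<and> X \<longleftrightarrow>
        rec_eval f xs a \<and> (\<exists>z. rec_eval (PrimRec f g) (s r # xs) z \<and> v = st 0 (s r) z) \<and> X" for a v X
        using 3[of a "s r" v] by blast
      then show ?thesis by (simp only:) blast
    qed
    finally have "(s, t) \<in> sem (compile (PrimRec f g) rs out b) \<longleftrightarrow>
        (\<exists>a z. rec_eval f xs a \<and> rec_eval (PrimRec f g) (s r # xs) z \<and> t = s(out := s out + z))"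
      unfolding 4 .
    \<comment> \<open>Unfolding the recursion down to 0 yields a value of the base case, so the
      program does not block before the loop.\<close>
    moreover have "\<exists>a. rec_eval f xs a" if "rec_eval (PrimRec f g) (n # xs) z" for n z
      using that by (induction n arbitrary: z)
        (auto simp: rec_eval_PrimRec_0_iff rec_eval_PrimRec_Suc_iff)
    ultimately show ?thesis unfolding Cons list.map xs_def[symmetric] by blast
  qed
qed

text \<open>Register \<open>b\<close> holds the candidate and \<open>b + 1\<close> the value of
  \<open>f\<close> there. \<open>Dec (b + 1)\<close> lets the search continue only if this value is
  positive, \<open>Test0 (b + 1)\<close> lets it end only if it is 0; together they check the
  condition for minimisation, including definedness at smaller candidates.\<close>

lemma computes_Mu:
  assumes f: "computes f"
  shows "computes (Mu f)"
  unfolding computes_def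
proof (intro allI impI)
  fix rs :: "nat list" and out b :: nat and s t :: store
  assume *: "\<forall>r\<in>set rs. r < b" "out < b" "out \<notin> set rs" "\<forall>r\<ge>b. s r = 0"
  define xs where "xs = map s rs"
  define st where "st j v = s(b := j, b + 1 := v)" for j v
  define body where "body = Seq (Dec (b + 1)) (Seq (clear (b + 1)) (Seq (Inc b)
    (compile f (b # rs) (b + 1) (b + 2))))"
  have s0: "s b = 0" "s (b + 1) = 0" using * by auto
  have s: "s = st 0 0" using s0 by (auto simp: st_def)
  have st: "st j v b = j" "st j v (b + 1) = v" "(st j v)(b := i) = st i v"
    "(st j v)(b + 1 := i) = st j i" for j v i
    by (auto simp: st_def)
  have f': "(st j 0, u) \<in> sem (compile f (b # rs) (b + 1) (b + 2)) \<longleftrightarrow>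
      (\<exists>y. rec_eval f (j # xs) y \<and> u = st j y)" for j u
  proof -
    have rs: "map (st j 0) rs = xs" using *(1) by (auto simp: st_def xs_def)
    have "\<forall>r\<in>set (b # rs). r < b + 2" "b + 1 < b + 2" "b + 1 \<notin> set (b # rs)"
      "\<forall>r\<ge>b + 2. st j 0 r = 0"
      using * by (auto simp: st_def)
    from computesD[OF f this] show ?thesis by (simp only: list.map st rs) simp
  qed
  have body: "(st j v, u) \<in> sem body \<longleftrightarrow>
      0 < v \<and> (\<exists>y. rec_eval f (Suc j # xs) y \<and> u = st (Suc j) y)" for j v u
  proof -
    have "(st j v, u) \<in> sem body \<longleftrightarrow>
      0 < v \<and> (st (Suc j) 0, u) \<in> sem (compile f (b # rs) (b + 1) (b + 2))"
      unfolding body_def sem_Seq sem_clear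
      by (simp add: st del: fun_upd_apply One_nat_def add_Suc_right add_2_eq_Suc')
    then show ?thesis by (simp only: f')
  qed
  have relpow: "(\<exists>v. rec_eval f (0 # xs) v \<and> (st 0 v, u) \<in> sem body ^^ m) \<longleftrightarrow>
      (\<forall>k<m. \<exists>y. rec_eval f (k # xs) (Suc y)) \<and> (\<exists>y. rec_eval f (m # xs) y \<and> u = st m y)" for m u
  proof (induction m arbitrary: u)
    case (Suc m)
    have "(\<exists>v. rec_eval f (0 # xs) v \<and> (st 0 v, u) \<in> sem body ^^ Suc m) \<longleftrightarrow>
        (\<exists>w. (\<exists>v. rec_eval f (0 # xs) v \<and> (st 0 v, w) \<in> sem body ^^ m) \<and> (w, u) \<in> sem body)"
      by auto
    also have "\<dots> \<longleftrightarrow> (\<forall>k<Suc m. \<exists>y. rec_eval f (k # xs) (Suc y)) \<and>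
        (\<exists>y. rec_eval f (Suc m # xs) y \<and> u = st (Suc m) y)"
      (is "?l \<longleftrightarrow> ?r")
    proof
      assume ?l
      then obtain v where "\<forall>k<m. \<exists>y. rec_eval f (k # xs) (Suc y)" "rec_eval f (m # xs) v"
        "(st m v, u) \<in> sem body"
        unfolding Suc by blast
      then show ?r unfolding body by (auto simp: less_Suc_eq gr0_conv_Suc)
    next
      assume ?r
      then obtain y v where "\<forall>k<m. \<exists>y. rec_eval f (k # xs) (Suc y)" "rec_eval f (m # xs) (Suc v)"
        "rec_eval f (Suc m # xs) y" "u = st (Suc m) y"
        by (auto simp: less_Suc_eq)
      then show ?l unfolding Suc by (intro exI[of _ "st m (Suc v)"]) (auto simp: body)
    qed
    finally show ?case .
  qed auto
  have final: "(st j v, t) \<in> sem (Seq (Test0 (b + 1)) (move b out)) \<longleftrightarrow>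
      v = 0 \<and> t = s(out := s out + j)" for j v
  proof -
    have "(st j 0)(b := 0, out := s out + j) = s(out := s out + j)"
      using s0 * by (auto simp: st_def)
    moreover have "st j 0 out = s out" "b \<noteq> out" using * by (auto simp: st_def)
    moreover have "st j v (Suc b) = v" using st(2) by simp
    ultimately show ?thesis by (auto simp: sem_Seq st simp del: sem.simps(5))
  qed
  have "(s, t) \<in> sem (compile (Mu f) rs out b) \<longleftrightarrow>
      (\<exists>u m. (\<exists>v. rec_eval f (0 # xs) v \<and> (st 0 v, u) \<in> sem body ^^ m) \<and>
        (u, t) \<in> sem (Seq (Test0 (b + 1)) (move b out)))"
    unfolding compile.simps body_def[symmetric] sem_Seq[of _ _ "compile _ _ _ _"]
        sem_Seq[of _ _ "Loop _"] sem.simps(6) rtrancl_power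
    unfolding f'[of 0, folded s] by blast
  also have "\<dots> \<longleftrightarrow> (\<exists>y. rec_eval (Mu f) xs y \<and> t = s(out := s out + y))"
    (is "?l \<longleftrightarrow> ?r")
  proof
    assume ?l
    then obtain m y where "\<forall>k<m. \<exists>y. rec_eval f (k # xs) (Suc y)" "rec_eval f (m # xs) y"
      "(st m y, t) \<in> sem (Seq (Test0 (b + 1)) (move b out))"
      unfolding relpow by blast
    then show ?r unfolding rec_eval_Mu_iff final by auto
  next
    assume ?r
    then obtain m where "\<forall>k<m. \<exists>y. rec_eval f (k # xs) (Suc y)" "rec_eval f (m # xs) 0"
      "(st m 0, t) \<in> sem (Seq (Test0 (b + 1)) (move b out))"
      unfolding rec_eval_Mu_iff final by blast
    then show ?l unfolding relpow by blast
  qed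
  finally show "(s, t) \<in> sem (compile (Mu f) rs out b) \<longleftrightarrow>
      (\<exists>y. rec_eval (Mu f) (map s rs) y \<and> t = s(out := s out + y))"
    by (simp only: xs_def)
qed

theorem computes: "computes f"
proof (induction f)
  case Zero
  show ?case by (auto simp: computes_def rec_eval_Zero_iff)
next
  case Succ
  show ?case
    by (auto simp: computes_def rec_eval_Succ_iff sem_Seq sem_copy simp del: sem.simps(5)
      split: list.splits)
next
  case (Proj i)
  show ?case
    unfolding computes_def
  proof (intro allI impI)
    fix rs :: "nat list" and out b :: nat and s t :: store
    assume *: "\<forall>r\<in>set rs. r < b" "out < b" "out \<notin> set rs" "\<forall>r\<ge>b. s r = 0"
    have "(s, t) \<in> sem (copy (rs ! i) out b) \<longleftrightarrow> t = s(out := s out + s (rs ! i))" if "i < length rs"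
      using that * nth_mem[OF that] by (intro sem_copy) auto
    then show "(s, t) \<in> sem (compile (Proj i) rs out b) \<longleftrightarrow>
        (\<exists>y. rec_eval (Proj i) (map s rs) y \<and> t = s(out := s out + y))"
      by (auto simp: rec_eval_Proj_iff)
  qed
qed (auto intro: computes_Comp computes_PrimRec computes_Mu)

section \<open>Control graphs of counter programs\<close>

text \<open>
  The rule \<open>(p, \<delta>, Z, q)\<close> leads from control state \<open>p\<close> to \<open>q\<close> and adds \<open>\<delta>\<close> to the registers, provided
  that all registers in \<open>Z\<close> are zero.
\<close>

type_synonym rule = "nat \<times> (nat \<Rightarrow> int) \<times> nat set \<times> nat"

definition fires :: "(nat \<Rightarrow> int) \<Rightarrow> nat set \<Rightarrow> store \<Rightarrow> store \<Rightarrow> bool" where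
  "fires \<delta> Z s t \<longleftrightarrow> (\<forall>r\<in>Z. s r = 0) \<and> (\<forall>r. int (t r) = int (s r) + \<delta> r)"

definition step :: "rule set \<Rightarrow> (nat \<times> store) rel" where
  "step S = {((p, s), (q, t)) | p s q t. \<exists>\<delta> Z. (p, \<delta>, Z, q) \<in> S \<and> fires \<delta> Z s t}"

text \<open>One set of stores for each control state, closed under firing: a bound from above on
  what is reachable, used to refute adherence.\<close>

definition invariant :: "rule set \<Rightarrow> (nat \<Rightarrow> store set) \<Rightarrow> bool" where
  "invariant S J \<longleftrightarrow> (\<forall>p \<delta> Z q s t. (p, \<delta>, Z, q) \<in> S \<longrightarrow> s \<in> J p \<longrightarrow> fires \<delta> Z s t \<longrightarrow> t \<in> J q)"

text \<open>The size of the interval of fresh states that \<open>rules\<close> allocates besides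
  entry and exit.\<close>

fun inner_states :: "prog \<Rightarrow> nat" where
  "inner_states (Seq p q) = Suc (inner_states p + inner_states q)"
| "inner_states (Loop p) = Suc (inner_states p)"
| "inner_states _ = 0"

fun reg_bound :: "prog \<Rightarrow> nat" where
  "reg_bound Skip = 0"
| "reg_bound (Inc r) = Suc r"
| "reg_bound (Dec r) = Suc r"
| "reg_bound (Test0 r) = Suc r"
| "reg_bound (Seq p q) = max (reg_bound p) (reg_bound q)"
| "reg_bound (Loop p) = reg_bound p"

text \<open>Entry state \<open>i\<close>, exit state \<open>j\<close>, and fresh states from \<open>n\<close> on.\<close>

fun rules :: "prog \<Rightarrow> nat \<Rightarrow> nat \<Rightarrow> nat \<Rightarrow> rule list" where
  "rules Skip i j n = [(i, \<lambda>_. 0, {}, j)]"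
| "rules (Inc r) i j n = [(i, (\<lambda>_. 0)(r := 1), {}, j)]"
| "rules (Dec r) i j n = [(i, (\<lambda>_. 0)(r := -1), {}, j)]"
| "rules (Test0 r) i j n = [(i, \<lambda>_. 0, {r}, j)]"
| "rules (Seq p q) i j n = rules p i n (Suc n) @ rules q n j (Suc n + inner_states p)"
| "rules (Loop p) i j n = (i, \<lambda>_. 0, {}, n) # (n, \<lambda>_. 0, {}, j) # rules p n n (Suc n)"

text \<open>A rule must not change a register that it tests, because the zero test will be imposed
  on both ends of a transition.\<close>

definition wf_rule :: "nat \<Rightarrow> nat \<Rightarrow> rule \<Rightarrow> bool" where
  "wf_rule R Q = (\<lambda>(p, \<delta>, Z, q). p < Q \<and> q < Q \<and> Z \<subseteq> {..<R} \<and>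
    (\<forall>r\<ge>R. \<delta> r = 0) \<and> (\<forall>r\<in>Z. \<delta> r = 0))"

section \<open>Paths and invariants of control graphs\<close>

lemma fires_zero: "fires (\<lambda>_. 0) Z s t \<longleftrightarrow> (\<forall>r\<in>Z. s r = 0) \<and> t = s"
  by (auto simp: fires_def)

lemma fires_inc: "fires ((\<lambda>_. 0)(r := 1)) {} s t \<longleftrightarrow> t = s(r := Suc (s r))"
  by (force simp: fires_def fun_eq_iff)

lemma fires_dec: "fires ((\<lambda>_. 0)(r := -1)) {} s t \<longleftrightarrow> 0 < s r \<and> t = s(r := s r - 1)"
  by (force simp: fires_def fun_eq_iff)

lemma rules_states:
  "(p, \<delta>, Z, q) \<in> set (rules c i j n) \<Longrightarrow>
    p \<in> {i, j} \<union> {n..<n + inner_states c} \<and> q \<in> {i, j} \<union> {n..<n + inner_states c}"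
  by (induction c i j n rule: rules.induct) auto

lemma wf_rules:
  "(p, \<delta>, Z, q) \<in> set (rules c i j n) \<Longrightarrow>
    Z \<subseteq> {..<reg_bound c} \<and> (\<forall>r\<ge>reg_bound c. \<delta> r = 0) \<and> (\<forall>r\<in>Z. \<delta> r = 0)"
  by (induction c i j n rule: rules.induct) (auto simp: less_max_iff_disj)

lemma stepI: "(p, \<delta>, Z, q) \<in> S \<Longrightarrow> fires \<delta> Z s t \<Longrightarrow> ((p, s), (q, t)) \<in> step S"
  by (auto simp: step_def)

text \<open>\<open>S\<close> is any superset of the rules of \<open>c\<close>, so that the induction
  applies to subprograms inside the whole program.\<close>

lemma sem_imp_steps:
  "(s, t) \<in> sem c \<Longrightarrow> set (rules c i j n) \<subseteq> S \<Longrightarrow> ((i, s), (j, t)) \<in> (step S)\<^sup>*"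
proof (induction c arbitrary: s t i j n)
  case (Seq p q)
  then obtain u where "(s, u) \<in> sem p" "(u, t) \<in> sem q" by auto
  with Seq.IH(1)[of s u i n "Suc n"] Seq.IH(2)[of u t n j "Suc n + inner_states p"] Seq.prems(2)
  show ?case by (auto intro: rtrancl_trans)
next
  case (Loop p)
  have "(s, t) \<in> (sem p)\<^sup>*" using Loop.prems by simp
  then have "((n, s), (n, t)) \<in> (step S)\<^sup>*"
  proof induction
    case (step u v)
    have "((n, u), (n, v)) \<in> (step S)\<^sup>*"
      using Loop.IH[OF step(2), of n n "Suc n"] Loop.prems(2) by auto
    with step.IH show ?case by (rule rtrancl_trans)
  qed simp
  moreover have "((i, s), (n, s)) \<in> step S" "((n, t), (j, t)) \<in> step S"
    using Loop.prems(2) by (auto intro!: stepI simp: fires_zero)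
  ultimately show ?case
    by (meson converse_rtrancl_into_rtrancl rtrancl.rtrancl_into_rtrancl)
qed (auto intro!: r_into_rtrancl stepI simp: fires_zero fires_inc fires_dec)

text \<open>The counterpart of \<open>sem_imp_steps\<close>: sets at entry and exit that are
  compatible with \<open>sem c\<close> extend to the fresh states. All other states keep their sets,
  so the invariants of subprograms can be combined.\<close>

lemma invariant_extend:
  assumes "sem c `` J i \<subseteq> J j" "i < n" "j < n"
  shows "\<exists>J'. (\<forall>k. k < n \<or> n + inner_states c \<le> k \<longrightarrow> J' k = J k) \<and>
    invariant (set (rules c i j n)) J'"
  using assms
proof (induction c arbitrary: i j n J)
  case (Seq p q)
  \<comment> \<open>The intermediate state gets exactly the stores that \<open>p\<close> can
    produce.\<close>
  define J1 where "J1 = J(n := sem p `` J i)"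
  have "sem p `` J1 i \<subseteq> J1 n" using Seq.prems by (auto simp: J1_def)
  then obtain J2 where J2: "\<forall>k. k < Suc n \<or> Suc n + inner_states p \<le> k \<longrightarrow> J2 k = J1 k"
    and inv2: "invariant (set (rules p i n (Suc n))) J2"
    using Seq.IH(1)[of J1 i n "Suc n"] Seq.prems by auto
  have "sem q `` J2 n \<subseteq> J2 j" using Seq.prems J2 by (auto simp: J1_def)
  then obtain J3 where J3: "\<forall>k. k < Suc n + inner_states p \<or>
      Suc n + inner_states p + inner_states q \<le> k \<longrightarrow> J3 k = J2 k"
    and inv3: "invariant (set (rules q n j (Suc n + inner_states p))) J3"
    using Seq.IH(2)[of J2 n j "Suc n + inner_states p"] Seq.prems by auto
  \<comment> \<open>\<open>J3\<close> differs from \<open>J2\<close> at most in the fresh states of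
    \<open>q\<close>, which the rules of \<open>p\<close> do not mention.\<close>
  have "J3 k = J2 k" if "k \<in> {i, n} \<union> {Suc n..<Suc n + inner_states p}" for k
    using that J3 Seq.prems by auto
  then have "invariant (set (rules p i n (Suc n))) J3"
    using inv2 rules_states unfolding invariant_def by metis
  with inv3 have "invariant (set (rules (Seq p q) i j n)) J3"
    by (auto simp: invariant_def)
  moreover have "\<forall>k. k < n \<or> n + inner_states (Seq p q) \<le> k \<longrightarrow> J3 k = J k"
    using J2 J3 by (auto simp: J1_def)
  ultimately show ?case by blast
next
  case (Loop p)
  \<comment> \<open>The loop head gets the stores produced by any number of rounds.\<close>
  define J1 where "J1 = J(n := (sem p)\<^sup>* `` J i)"
  have "sem p `` J1 n \<subseteq> J1 n" by (auto simp: J1_def intro: rtrancl_into_rtrancl)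
  then obtain J2 where J2: "\<forall>k. k < Suc n \<or> Suc n + inner_states p \<le> k \<longrightarrow> J2 k = J1 k"
    and inv2: "invariant (set (rules p n n (Suc n))) J2"
    using Loop.IH[of J1 n n "Suc n"] by auto
  have "J2 i \<subseteq> J2 n" "J2 n \<subseteq> J2 j" using J2 Loop.prems by (auto simp: J1_def)
  with inv2 have "invariant (set (rules (Loop p) i j n)) J2"
    by (auto simp: invariant_def fires_zero)
  moreover have "\<forall>k. k < n \<or> n + inner_states (Loop p) \<le> k \<longrightarrow> J2 k = J k"
    using J2 by (auto simp: J1_def)
  ultimately show ?case by blast
next
  case Skip
  then have "invariant (set (rules Skip i j n)) J" by (auto simp: invariant_def fires_zero)
  then show ?case by blast
next
  case (Inc r)
  then have "invariant (set (rules (Inc r) i j n)) J" by (auto simp: invariant_def fires_inc)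
  then show ?case by blast
next
  case (Dec r)
  then have "invariant (set (rules (Dec r) i j n)) J" by (auto simp: invariant_def fires_dec)
  then show ?case by blast
next
  case (Test0 r)
  then have "invariant (set (rules (Test0 r) i j n)) J" by (auto simp: invariant_def fires_zero)
  then show ?case by blast
qed

section \<open>Adherence and loops\<close>

text \<open>The first \<open>R\<close> components hold the registers, the other \<open>Q\<close> the control state in unary.\<close>

definition cfg :: "nat \<Rightarrow> nat \<Rightarrow> nat \<Rightarrow> store \<Rightarrow> config" where
  "cfg R Q p s = map (\<lambda>i. if i < R then s i else of_bool (i = R + p)) [0..<R + Q]"

definition rule_action :: "nat \<Rightarrow> nat \<Rightarrow> rule \<Rightarrow> action" where
  "rule_action R Q = (\<lambda>(p, \<delta>, Z, q).
    map (\<lambda>i. if i < R then \<delta> i else of_bool (i = R + q) - of_bool (i = R + p)) [0..<R + Q])"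

text \<open>Upper bounds suffice to test registers for zero and also to identify the control state:
  an encoded store has exactly one 1 among its control components, and the guard allows it at
  position \<open>p\<close> only.\<close>

definition guard :: "nat \<Rightarrow> nat \<Rightarrow> nat set \<Rightarrow> nat \<Rightarrow> ovec" where
  "guard R Q Z p =
    map (\<lambda>i. if i < R then if i \<in> Z then 0 else \<infinity> else of_bool (i = R + p)) [0..<R + Q]"

definition rule_otriple :: "nat \<Rightarrow> nat \<Rightarrow> rule \<Rightarrow> otriple" where
  "rule_otriple R Q = (\<lambda>(p, \<delta>, Z, q).
    (guard R Q Z p, rule_action R Q (p, \<delta>, Z, q), guard R Q Z q))"

definition rules_instance :: "nat \<Rightarrow> nat \<Rightarrow> rule list \<Rightarrow> star_instance" where
  "rules_instance R Q rls = (R + Q, map (rule_action R Q) rls, cfg R Q 0 (\<lambda>_. 0),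
    map (rule_otriple R Q) rls)"

text \<open>A recursive form of the condition on runs, suited to concatenation.\<close>

fun chain :: "config \<Rightarrow> triple list \<Rightarrow> config \<Rightarrow> bool" where
  "chain u [] v \<longleftrightarrow> u = v"
| "chain u (t # w) v \<longleftrightarrow> fst t = u \<and> chain (snd (snd t)) w v"

lemma chain_append: "chain u (w @ w') v \<longleftrightarrow> (\<exists>m. chain u w m \<and> chain m w' v)"
  by (induction w arbitrary: u) auto

lemma chain_iff:
  "chain u w v \<longleftrightarrow> w = [] \<and> u = v \<or>
    w \<noteq> [] \<and> u = fst (hd w) \<and> v = snd (snd (last w)) \<and>
    (\<forall>j. Suc j < length w \<longrightarrow> fst (w ! Suc j) = snd (snd (w ! j)))"
proof (induction w arbitrary: u)
  case (Cons t w)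
  show ?case
  proof (cases w)
    case (Cons t' w')
    have "(\<forall>j. Suc j < length (t # w) \<longrightarrow> fst ((t # w) ! Suc j) = snd (snd ((t # w) ! j))) \<longleftrightarrow>
       fst t' = snd (snd t) \<and> (\<forall>j. Suc j < length w \<longrightarrow> fst (w ! Suc j) = snd (snd (w ! j)))"
      using All_less_Suc2[of "length w'" "\<lambda>j. fst ((t # w) ! Suc j) = snd (snd ((t # w) ! j))"]
      by (simp add: Cons)
    with Cons.IH[of "snd (snd t)"] Cons show ?thesis by auto
  qed auto
qed auto

lemma runs_iff:
  "(u, w, v) \<in> runs d A x y \<longleftrightarrow> u = x \<and> v = y \<and> length x = d \<and> length y = d \<and>
    set w \<subseteq> transitions d A \<and> chain x w y"
  unfolding chain_iff by (auto simp: runs_def preruns_def configs_def transitions_def)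

lemma triple_le_refl: "triple_le t t"
  by (cases t) (simp add: vec_le_refl)

lemma lists_down_closed:
  assumes "down_closed_in triple_le (triples d A) D"
    and "list_emb triple_le w w'" "w' \<in> lists D" "w \<in> lists (triples d A)"
  shows "w \<in> lists D"
  using assms(2-4)
  by induction (use assms(1) in \<open>auto simp: down_closed_in_def\<close>)

text \<open>Concatenating loops turns coverage of single letters into coverage of words.\<close>

lemma in_adherence_star:
  assumes D: "down_closed_in triple_le (triples d A) D" and x: "length x = d"
    and cover: "\<And>t. t \<in> D \<Longrightarrow> \<exists>w t'. set w \<subseteq> D \<inter> transitions d A \<and> chain x w x \<and>
      t' \<in> set w \<and> triple_le t t'"
  shows "in_adherence prerun_le (preruns d A) (star_preruns d A x D) (runs d A x x)"
proof -
  \<comment> \<open>All loops on \<open>x\<close> with letters in \<open>D\<close> are taken at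
    once.\<close>
  define \<Delta> where "\<Delta> = {(u, w, v). (u, w, v) \<in> runs d A x x \<and> w \<in> lists D}"
  have \<Delta>: "(x, w, x) \<in> \<Delta> \<longleftrightarrow> set w \<subseteq> D \<inter> transitions d A \<and> chain x w x" for w
    using x by (auto simp: \<Delta>_def runs_iff)
  have \<Delta>_x: "u = x \<and> v = x" if "(u, w, v) \<in> \<Delta>" for u w v
    using that by (auto simp: \<Delta>_def runs_iff)
  have words: "\<exists>w'. (x, w', x) \<in> \<Delta> \<and> list_emb triple_le w w'" if "w \<in> lists D" for w
    using that
  proof induction
    case Nil
    show ?case by (intro exI[of _ "[]"]) (simp add: \<Delta>)
  next
    case (Cons t w)
    then obtain w' where w': "(x, w', x) \<in> \<Delta>" "list_emb triple_le w w'" by blast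
    from cover[OF Cons.hyps(1)] obtain v t' where v: "set v \<subseteq> D \<inter> transitions d A" "chain x v x"
      "t' \<in> set v" "triple_le t t'" by blast
    from v(3) obtain v1 v2 where "v = v1 @ t' # v2" by (auto simp: in_set_conv_decomp)
    then have "list_emb triple_le [t] v"
      using v(4) by (auto intro!: list_emb_append2 simp del: triple_le.simps)
    with w'(2) have "list_emb triple_le (t # w) (v @ w')"
      using list_emb_append_mono[of triple_le "[t]" v w w'] by simp
    moreover have "(x, v @ w', x) \<in> \<Delta>" using v w' unfolding \<Delta> by (auto simp: chain_append)
    ultimately show ?case by blast
  qed
  have "directed_set prerun_le \<Delta>"
    unfolding directed_set_def
  proof (intro ballI)
    fix r s assume rs: "r \<in> \<Delta>" "s \<in> \<Delta>"
    obtain w v where r: "r = (x, w, x)" and s: "s = (x, v, x)"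
      using rs \<Delta>_x by (cases r; cases s) blast
    from rs have "w @ v \<in> lists D" by (auto simp: r s \<Delta>)
    from words[OF this] obtain w' where w': "(x, w', x) \<in> \<Delta>" "list_emb triple_le (w @ v) w'" by blast
    have "list_emb triple_le w w'" "list_emb triple_le v w'"
      using w'(2) by (auto dest!: list_emb_appendD)
    then show "\<exists>t\<in>\<Delta>. prerun_le r t \<and> prerun_le s t"
      using w'(1) by (intro bexI[of _ "(x, w', x)"]) (auto simp: r s vec_le_refl)
  qed
  moreover have "down_in prerun_le (preruns d A) \<Delta> = star_preruns d A x D"
  proof (rule set_eqI)
    fix r :: prerun
    obtain u w v where r: "r = (u, w, v)" by (cases r)
    show "r \<in> down_in prerun_le (preruns d A) \<Delta> \<longleftrightarrow> r \<in> star_preruns d A x D"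
    proof
      assume "r \<in> down_in prerun_le (preruns d A) \<Delta>"
      then obtain s where s: "s \<in> \<Delta>" "prerun_le r s" "r \<in> preruns d A"
        by (auto simp: down_in_def)
      obtain w' where w': "s = (x, w', x)" using s(1) \<Delta>_x by (cases s) blast
      have "w \<in> lists D"
        using s by (intro lists_down_closed[OF D, of w w']) (auto simp: r w' \<Delta> preruns_def)
      with s show "r \<in> star_preruns d A x D" by (auto simp: star_preruns_def r w')
    next
      assume "r \<in> star_preruns d A x D"
      then have r': "r \<in> preruns d A" "vec_le u x" "vec_le v x" "w \<in> lists D"
        by (auto simp: star_preruns_def r)
      from words[OF r'(4)] obtain w' where w': "(x, w', x) \<in> \<Delta>" "list_emb triple_le w w'" by blast
      with r' have "prerun_le r (x, w', x)" by (simp add: r)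
      with w'(1) r'(1) show "r \<in> down_in prerun_le (preruns d A) \<Delta>"
        unfolding down_in_def by blast
    qed
  qed
  moreover have "\<Delta> \<subseteq> runs d A x x" by (auto simp: \<Delta>_def)
  ultimately show ?thesis unfolding in_adherence_def by blast
qed

text \<open>The one-letter prerun \<open>(x, [t], x)\<close> belongs to the star set, so it lies
  below a run in the directed set. That run lies in its own downward closure, which is the star set,
  so all its letters are in \<open>D\<close>.\<close>

lemma in_adherence_starD:
  assumes adh: "in_adherence prerun_le (preruns d A) (star_preruns d A x D) (runs d A x x)"
    and x: "length x = d" and t: "t \<in> D" "D \<subseteq> triples d A"
  obtains w t' where "set w \<subseteq> D \<inter> transitions d A" "chain x w x" "t' \<in> set w" "triple_le t t'"
proof -
  from adh obtain \<Delta> where \<Delta>: "\<Delta> \<subseteq> runs d A x x"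
    "down_in prerun_le (preruns d A) \<Delta> = star_preruns d A x D"
    unfolding in_adherence_def by blast
  have "(x, [t], x) \<in> star_preruns d A x D"
    using t x by (auto simp: star_preruns_def preruns_def configs_def vec_le_refl)
  then obtain s where s: "s \<in> \<Delta>" "prerun_le (x, [t], x) s"
    using \<Delta>(2) unfolding down_in_def by blast
  with \<Delta>(1) obtain w where w: "s = (x, w, x)" "set w \<subseteq> transitions d A" "chain x w x"
    by (cases s) (force simp: runs_iff)
  have "s \<in> preruns d A" using w x by (auto simp: preruns_def configs_def transitions_def)
  moreover have "prerun_le s s"
    by (simp add: w vec_le_refl list_emb_refl triple_le_refl del: triple_le.simps)
  ultimately have "s \<in> star_preruns d A x D" using s(1) \<Delta>(2) unfolding down_in_def by blast
  then have "set w \<subseteq> D" by (auto simp: star_preruns_def w)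
  moreover obtain t' where "t' \<in> set w" "triple_le t t'"
    using s(2) list_emb_set[of triple_le "[t]" w t] by (auto simp: w simp del: triple_le.simps)
  ultimately show thesis using that w by blast
qed

section \<open>Letters and transitions as machine steps\<close>

lemma length_cfg [simp]: "length (cfg R Q p s) = R + Q"
  by (simp add: cfg_def)

lemma nth_cfg: "i < R + Q \<Longrightarrow> cfg R Q p s ! i = (if i < R then s i else of_bool (i = R + p))"
  by (simp add: cfg_def del: upt_Suc)

lemma length_rule_action [simp]: "length (rule_action R Q \<rho>) = R + Q"
  by (simp add: rule_action_def split: prod.splits)

lemma nth_rule_action:
  "i < R + Q \<Longrightarrow> rule_action R Q (p, \<delta>, Z, q) ! i =
    (if i < R then \<delta> i else of_bool (i = R + q) - of_bool (i = R + p))"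
  by (simp add: rule_action_def)

lemma length_guard [simp]: "length (guard R Q Z p) = R + Q"
  by (simp add: guard_def)

lemma nth_guard:
  "i < R + Q \<Longrightarrow> guard R Q Z p ! i =
    (if i < R then if i \<in> Z then 0 else \<infinity> else of_bool (i = R + p))"
  by (simp add: guard_def)

lemma mem_below_guard:
  "u \<in> below (guard R Q Z p) \<longleftrightarrow> length u = R + Q \<and> (\<forall>i<R. i \<in> Z \<longrightarrow> u ! i = 0) \<and>
    (\<forall>i<Q. u ! (R + i) \<le> of_bool (i = p))"
proof -
  have "u \<in> below (guard R Q Z p) \<longleftrightarrow> length u = R + Q \<and>
    (\<forall>i<R + Q. enat (u ! i) \<le> (if i < R then if i \<in> Z then 0 else \<infinity> else of_bool (i = R + p)))"
    by (simp add: below_def list_all2_conv_all_nth nth_guard cong: conj_cong)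
  also have "\<dots> \<longleftrightarrow> length u = R + Q \<and> (\<forall>i<R. i \<in> Z \<longrightarrow> u ! i = 0) \<and>
    (\<forall>i<Q. u ! (R + i) \<le> of_bool (i = p))"
    (is "_ \<and> ?l \<longleftrightarrow> _ \<and> ?r")
  proof -
    have "?l \<longleftrightarrow> (\<forall>i<R. enat (u ! i) \<le> (if i \<in> Z then 0 else \<infinity>)) \<and>
        (\<forall>i<Q. enat (u ! (R + i)) \<le> of_bool (i = p))"
      by (auto simp: all_conj_distrib) (metis add_diff_inverse_nat nat_add_left_cancel_less)+
    moreover have "enat n \<le> 0 \<longleftrightarrow> n = 0" "enat n \<le> of_bool b \<longleftrightarrow> n \<le> of_bool b" for n b
      by (auto simp: zero_enat_def one_enat_def)
    ultimately show ?thesis by auto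
  qed
  finally show ?thesis .
qed

lemma below_guard_down:
  assumes "u \<in> below (guard R Q Z p)" "vec_le u' u"
  shows "u' \<in> below (guard R Q Z p)"
proof -
  have "length u' = length u" "\<And>i. i < length u \<Longrightarrow> u' ! i \<le> u ! i"
    using assms(2) by (auto simp: vec_le_def list_all2_conv_all_nth)
  with assms(1) show ?thesis
    unfolding mem_below_guard
    by (metis bot_nat_0.extremum_uniqueI le_trans nat_add_left_cancel_less trans_less_add1)
qed

lemma cfg_mem_below_guard:
  "p < Q \<Longrightarrow> Z \<subseteq> {..<R} \<Longrightarrow> cfg R Q p s \<in> below (guard R Q Z p') \<longleftrightarrow>
    p = p' \<and> (\<forall>r\<in>Z. s r = 0)"
  by (auto simp: mem_below_guard nth_cfg)

lemma rule_otriple_set: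
  "(u, a, v) \<in> otriple_set (rule_otriple R Q (p, \<delta>, Z, q)) \<longleftrightarrow>
    u \<in> below (guard R Q Z p) \<and> a = rule_action R Q (p, \<delta>, Z, q) \<and> v \<in> below (guard R Q Z q)"
  by (simp add: rule_otriple_def)

lemma fires_imp_transition:
  assumes "wf_rule R Q (p, \<delta>, Z, q)" "fires \<delta> Z s t" "rule_action R Q (p, \<delta>, Z, q) \<in> A"
  shows "(cfg R Q p s, rule_action R Q (p, \<delta>, Z, q), cfg R Q q t) \<in>
    otriple_set (rule_otriple R Q (p, \<delta>, Z, q)) \<inter> transitions (R + Q) A"
proof -
  have "\<forall>r\<in>Z. t r = 0"
  proof
    fix r assume "r \<in> Z"
    then have "int (t r) = int (s r) + \<delta> r" "s r = 0" "\<delta> r = 0"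
      using assms by (auto simp: wf_rule_def fires_def)
    then show "t r = 0" by simp
  qed
  then show ?thesis
    using assms
    by (auto simp: rule_otriple_set transitions_def triples_def configs_def nth_cfg nth_rule_action
      wf_rule_def fires_def cfg_mem_below_guard)
qed

text \<open>If the source is an encoded store, the guard determines its control state and the action
  determines the target, which is again an encoded store.\<close>

lemma transition_imp_fires:
  assumes wf: "wf_rule R Q (p, \<delta>, Z, q)" and p': "p' < Q"
    and mem: "(cfg R Q p' s, a, v) \<in> otriple_set (rule_otriple R Q (p, \<delta>, Z, q))"
    and trans: "(cfg R Q p' s, a, v) \<in> transitions (R + Q) A"
    and s: "\<forall>r\<ge>R. s r = 0"
  obtains t where "p' = p" "v = cfg R Q q t" "fires \<delta> Z s t" "\<forall>r\<ge>R. t r = 0"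
proof
  \<comment> \<open>Registers from \<open>R\<close> on are not represented in \<open>v\<close>;
    their value is 0.\<close>
  let ?t = "\<lambda>r. if r < R then v ! r else 0"
  have Z: "Z \<subseteq> {..<R}" and a: "a = rule_action R Q (p, \<delta>, Z, q)"
    using wf mem by (auto simp: wf_rule_def rule_otriple_set)
  show p: "p' = p" and "\<forall>r\<ge>R. ?t r = 0"
    using mem p' Z by (auto simp: rule_otriple_set cfg_mem_below_guard)
  have "\<forall>r\<in>Z. s r = 0" using mem p' Z by (simp add: rule_otriple_set cfg_mem_below_guard)
  have v: "length v = R + Q" "\<And>i. i < R + Q \<Longrightarrow> int (v ! i) = int (cfg R Q p' s ! i) + a ! i"
    using trans by (auto simp: transitions_def triples_def configs_def)
  show "v = cfg R Q q ?t"
  proof (rule nth_equalityI)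
    fix i assume "i < length v"
    then show "v ! i = cfg R Q q ?t ! i"
      using v(1) v(2)[of i] by (auto simp: nth_cfg nth_rule_action a p split: if_splits)
  qed (simp add: v)
  show "fires \<delta> Z s ?t"
    unfolding fires_def
  proof (intro conjI allI)
    fix r show "int (?t r) = int (s r) + \<delta> r"
      using v(2)[of r] s wf by (auto simp: nth_cfg nth_rule_action a wf_rule_def)
  qed fact
qed

text \<open>Registers that are not tested are unbounded in both guards, so the rule can be fired at
  values above those of any given triple.\<close>

lemma rule_otriple_cover:
  assumes wf: "wf_rule R Q (p, \<delta>, Z, q)"
    and mem: "(u, a, v) \<in> otriple_set (rule_otriple R Q (p, \<delta>, Z, q))"
  obtains s t where "fires \<delta> Z s t" "\<forall>r\<ge>R. s r = 0"
    "triple_le (u, a, v) (cfg R Q p s, rule_action R Q (p, \<delta>, Z, q), cfg R Q q t)"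
proof
  \<comment> \<open>The summand \<open>u ! r\<close> takes care of the source. The other two give a
    target of at least \<open>v ! r\<close> and keep it nonnegative, so that \<open>nat\<close> in
    \<open>t\<close> loses nothing.\<close>
  define s where "s r = (if r < R \<and> r \<notin> Z then u ! r + v ! r + nat \<bar>\<delta> r\<bar> else 0)" for r
  define t where "t r = nat (int (s r) + \<delta> r)" for r
  show "fires \<delta> Z s t" "\<forall>r\<ge>R. s r = 0"
    using wf by (auto simp: fires_def s_def t_def wf_rule_def)
  have le: "u ! r \<le> s r" "v ! r \<le> t r" if "r < R" for r
    using mem that by (auto simp: s_def t_def rule_otriple_set mem_below_guard)
  have st: "u ! i \<le> of_bool (i = R + p)" "v ! i \<le> of_bool (i = R + q)" if "R \<le> i" "i < R + Q" for i
  proof -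
    from that obtain j where "i = R + j" "j < Q" by (metis le_iff_add nat_add_left_cancel_less)
    with mem show "u ! i \<le> of_bool (i = R + p)" "v ! i \<le> of_bool (i = R + q)"
      by (auto simp: rule_otriple_set mem_below_guard)
  qed
  show "triple_le (u, a, v) (cfg R Q p s, rule_action R Q (p, \<delta>, Z, q), cfg R Q q t)"
    using mem le st
    by (auto simp: rule_otriple_set mem_below_guard vec_le_def list_all2_conv_all_nth nth_cfg)
qed

section \<open>The instance defined by a set of rules\<close>

locale counter_system =
  fixes R Q :: nat and rls :: "rule list"
  assumes wf: "\<rho> \<in> set rls \<Longrightarrow> wf_rule R Q \<rho>" and Q_pos: "0 < Q"
begin

abbreviation "A \<equiv> set (map (rule_action R Q) rls)"
abbreviation "D \<equiv> otriples_set (map (rule_otriple R Q) rls)"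
abbreviation "x \<equiv> cfg R Q 0 (\<lambda>_. 0)"

lemma D_cases:
  assumes "(u, a, v) \<in> D"
  obtains p \<delta> Z q where "(p, \<delta>, Z, q) \<in> set rls"
    "(u, a, v) \<in> otriple_set (rule_otriple R Q (p, \<delta>, Z, q))"
  using assms by (auto simp: otriples_set_def simp del: otriple_set.simps)

lemma fires_D:
  assumes "(p, \<delta>, Z, q) \<in> set rls" "fires \<delta> Z s t"
  shows "(cfg R Q p s, rule_action R Q (p, \<delta>, Z, q), cfg R Q q t) \<in> D \<inter> transitions (R + Q) A"
  using fires_imp_transition[OF wf[OF assms(1)] assms(2), of A] assms(1)
  by (auto simp: otriples_set_def simp del: otriple_set.simps)

lemma D_subset_triples: "D \<subseteq> triples (R + Q) A"
proof
  fix t assume "t \<in> D"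
  moreover obtain u a v where t: "t = (u, a, v)" by (cases t)
  ultimately obtain p \<delta> Z q where "(p, \<delta>, Z, q) \<in> set rls"
    "(u, a, v) \<in> otriple_set (rule_otriple R Q (p, \<delta>, Z, q))" using D_cases[of u a v] by blast
  then show "t \<in> triples (R + Q) A"
    by (auto simp: t rule_otriple_set triples_def configs_def mem_below_guard)
qed

text \<open>\<open>D\<close> is the downward closure of its own transitions: one inclusion is
  \<open>rule_otriple_cover\<close>, the other holds because guards are upper bounds.\<close>

lemma D_down_closed_transition_set: "down_closed_transition_set (R + Q) A D"
  unfolding down_closed_transition_set_def
proof (intro exI conjI)
  let ?T = "D \<inter> transitions (R + Q) A"
  show "?T \<subseteq> transitions (R + Q) A" by blast
  show "D = down_in triple_le (triples (R + Q) A) ?T"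
  proof (rule set_eqI)
    fix r :: triple
    obtain u a v where r: "r = (u, a, v)" by (cases r)
    show "r \<in> D \<longleftrightarrow> r \<in> down_in triple_le (triples (R + Q) A) ?T"
    proof
      assume rD: "r \<in> D"
      then obtain p \<delta> Z q where rule: "(p, \<delta>, Z, q) \<in> set rls"
        and mem: "(u, a, v) \<in> otriple_set (rule_otriple R Q (p, \<delta>, Z, q))"
        unfolding r by (rule D_cases)
      from rule_otriple_cover[OF wf[OF rule] mem] obtain s t where "fires \<delta> Z s t"
        and "triple_le r (cfg R Q p s, rule_action R Q (p, \<delta>, Z, q), cfg R Q q t)"
        unfolding r .
      with fires_D[OF rule] rD D_subset_triples show "r \<in> down_in triple_le (triples (R + Q) A) ?T"
        unfolding down_in_def by blast
    next
      assume "r \<in> down_in triple_le (triples (R + Q) A) ?T"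
      then obtain s where s: "s \<in> D" "triple_le r s" by (auto simp: down_in_def)
      obtain u' a' v' where s': "s = (u', a', v')" by (cases s)
      from s obtain p \<delta> Z q where rule: "(p, \<delta>, Z, q) \<in> set rls"
        and mem: "(u', a', v') \<in> otriple_set (rule_otriple R Q (p, \<delta>, Z, q))"
        unfolding s' by (elim D_cases)
      have "(u, a, v) \<in> otriple_set (rule_otriple R Q (p, \<delta>, Z, q))"
        using mem s(2) below_guard_down by (auto simp: r s' rule_otriple_set)
      with rule show "r \<in> D" by (auto simp: r otriples_set_def simp del: otriple_set.simps)
    qed
  qed
qed

lemma rules_instance_valid: "rules_instance R Q rls \<in> star_instances"
proof -
  have "wf_otriple (R + Q) A t" if "t \<in> set (map (rule_otriple R Q) rls)" for t
    using that by (auto simp: rule_otriple_def guard_def)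
  then show ?thesis
    using D_down_closed_transition_set
    by (auto simp: star_instances_def rules_instance_def vas_def configs_def)
qed

lemma steps_imp_chain:
  assumes "((p, s), (q, t)) \<in> (step (set rls))\<^sup>*"
  obtains w where "set w \<subseteq> D \<inter> transitions (R + Q) A" "chain (cfg R Q p s) w (cfg R Q q t)"
proof -
  have "\<exists>w. set w \<subseteq> D \<inter> transitions (R + Q) A \<and> chain (cfg R Q p s) w (cfg R Q q t)"
    using assms
  proof (induction rule: rtrancl_induct2)
    case refl
    show ?case by (intro exI[of _ "[]"]) auto
  next
    case (step p' s' q' t')
    then obtain w \<delta> Z where w: "set w \<subseteq> D \<inter> transitions (R + Q) A"
        "chain (cfg R Q p s) w (cfg R Q p' s')"
      and rule: "(p', \<delta>, Z, q') \<in> set rls" "fires \<delta> Z s' t'"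
      by (auto simp: step_def)
    from fires_D[OF rule] w show ?case
      by (intro exI[of _ "w @ [(cfg R Q p' s', rule_action R Q (p', \<delta>, Z, q'), cfg R Q q' t')]"])
        (auto simp: chain_append)
  qed
  with that show thesis by blast
qed

text \<open>Each letter of \<open>D\<close> lies below a firing of a rule, and the two assumed paths
  complete this firing to a loop on \<open>x\<close>.\<close>

lemma in_adherenceI:
  assumes "\<And>p \<delta> Z q s t. (p, \<delta>, Z, q) \<in> set rls \<Longrightarrow> fires \<delta> Z s t \<Longrightarrow> \<forall>r\<ge>R. s r = 0 \<Longrightarrow>
    ((0, \<lambda>_. 0), (p, s)) \<in> (step (set rls))\<^sup>* \<and> ((q, t), (0, \<lambda>_. 0)) \<in> (step (set rls))\<^sup>*"
  shows "star_in_adherence (rules_instance R Q rls)"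
  unfolding rules_instance_def star_in_adherence.simps
proof (rule in_adherence_star)
  show "down_closed_in triple_le (triples (R + Q) A) D"
    by (intro down_closed_transition_set_imp_down_closed D_down_closed_transition_set)
  fix r assume "r \<in> D"
  moreover obtain u a v where r: "r = (u, a, v)" by (cases r)
  ultimately obtain p \<delta> Z q where rule: "(p, \<delta>, Z, q) \<in> set rls"
    and mem: "(u, a, v) \<in> otriple_set (rule_otriple R Q (p, \<delta>, Z, q))"
    using D_cases[of u a v] by blast
  from rule_otriple_cover[OF wf[OF rule] mem] obtain s t where st: "fires \<delta> Z s t" "\<forall>r\<ge>R. s r = 0"
    and le: "triple_le (u, a, v) (cfg R Q p s, rule_action R Q (p, \<delta>, Z, q), cfg R Q q t)" .
  let ?t = "(cfg R Q p s, rule_action R Q (p, \<delta>, Z, q), cfg R Q q t)"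
  from assms[OF rule st] obtain w w' where
    "set w \<subseteq> D \<inter> transitions (R + Q) A" "chain x w (cfg R Q p s)"
    "set w' \<subseteq> D \<inter> transitions (R + Q) A" "chain (cfg R Q q t) w' x"
    by (auto elim!: steps_imp_chain simp del: set_map)
  with fires_D[OF rule st(1)] le
  show "\<exists>w t'. set w \<subseteq> D \<inter> transitions (R + Q) A \<and> chain x w x \<and> t' \<in> set w \<and> triple_le r t'"
    unfolding r by (intro exI[of _ "w @ ?t # w'"] exI[of _ ?t]) (auto simp: chain_append)
qed simp

text \<open>By \<open>transition_imp_fires\<close> a chain in \<open>D\<close> that starts at an
  encoded store follows the machine step by step, so the invariant is carried along.\<close>

lemma chain_invariant:
  assumes inv: "invariant (set rls) J"
  shows "set w \<subseteq> D \<inter> transitions (R + Q) A \<Longrightarrow> chain (cfg R Q p s) w y \<Longrightarrow> p < Q \<Longrightarrow> s \<in> J p \<Longrightarrow>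
    \<forall>r\<ge>R. s r = 0 \<Longrightarrow> (u, a, v) \<in> set w \<Longrightarrow> \<exists>p s. p < Q \<and> s \<in> J p \<and> u = cfg R Q p s"
proof (induction w arbitrary: p s)
  case (Cons t w)
  obtain a' v' where t: "t = (cfg R Q p s, a', v')" using Cons.prems(2) by (cases t) auto
  with Cons.prems(1) have "(cfg R Q p s, a', v') \<in> D" by auto
  then obtain p' \<delta> Z q where rule: "(p', \<delta>, Z, q) \<in> set rls"
    and mem: "(cfg R Q p s, a', v') \<in> otriple_set (rule_otriple R Q (p', \<delta>, Z, q))"
    by (rule D_cases)
  have "(cfg R Q p s, a', v') \<in> transitions (R + Q) A" using Cons.prems(1) t by auto
  from transition_imp_fires[OF wf[OF rule] Cons.prems(3) mem this Cons.prems(5)]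
  obtain s' where s': "p = p'" "v' = cfg R Q q s'" "fires \<delta> Z s s'" "\<forall>r\<ge>R. s' r = 0" .
  have "s' \<in> J q" using inv rule s' Cons.prems(4) unfolding invariant_def by blast
  moreover have "q < Q" using wf[OF rule] by (simp add: wf_rule_def)
  ultimately show ?case
    using Cons.IH[of q s'] Cons.prems s' t by auto
qed simp

text \<open>A rule leaving a state with empty invariant yields a letter that no loop covers: the
  source of a covering letter has a positive entry at position \<open>R + p\<close>, hence is in
  state \<open>p\<close>.\<close>

lemma not_in_adherenceI:
  assumes inv: "invariant (set rls) J" and J0: "(\<lambda>_. 0) \<in> J 0"
    and rule: "(p, \<delta>, Z, q) \<in> set rls" "J p = {}"
  shows "\<not> star_in_adherence (rules_instance R Q rls)"
proof
  assume "star_in_adherence (rules_instance R Q rls)"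
  then have adh: "in_adherence prerun_le (preruns (R + Q) A) (star_preruns (R + Q) A x D)
      (runs (R + Q) A x x)"
    by (simp add: rules_instance_def)
  let ?t = "(cfg R Q p (\<lambda>_. 0), rule_action R Q (p, \<delta>, Z, q), cfg R Q q (\<lambda>_. 0))"
  have pq: "p < Q" "q < Q" "Z \<subseteq> {..<R}" using wf[OF rule(1)] by (auto simp: wf_rule_def)
  then have "?t \<in> otriple_set (rule_otriple R Q (p, \<delta>, Z, q))"
    by (simp add: rule_otriple_set cfg_mem_below_guard)
  with rule(1) have "?t \<in> D" by (auto simp: otriples_set_def simp del: otriple_set.simps)
  from in_adherence_starD[OF adh _ this D_subset_triples] obtain w t' where
    w: "set w \<subseteq> D \<inter> transitions (R + Q) A" "chain x w x" "t' \<in> set w" "triple_le ?t t'"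
    using length_cfg by blast
  obtain u a v where t': "t' = (u, a, v)" by (cases t')
  from chain_invariant[OF inv w(1,2) Q_pos J0 _ w(3)[unfolded t']] obtain p' s where
    p': "p' < Q" "s \<in> J p'" "u = cfg R Q p' s" by auto
  have "cfg R Q p (\<lambda>_. 0) ! (R + p) \<le> u ! (R + p)"
    using w(4) pq by (auto simp: t' vec_le_def list_all2_conv_all_nth)
  with pq p' have "p' = p" by (cases "p = p'") (auto simp: nth_cfg)
  with p' rule(2) show False by simp
qed

end

section \<open>Terminating machines and adherence\<close>

definition input_store :: "nat list \<Rightarrow> store" where
  "input_store cs r = (if r < length cs then cs ! r else 0)"

text \<open>
  State 0 is the initial one; 3 and 4 are the entry and the exit of the program. State 1 erases the
  registers and returns to the initial configuration. State 2, entered only when the program has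
  terminated, reaches every configuration.
\<close>

definition other_rules :: "prog \<Rightarrow> nat \<Rightarrow> nat \<Rightarrow> rule list" where
  "other_rules c R Q =
    rules c 3 4 5 @ [(4, \<lambda>_. 0, {}, 2), (1, \<lambda>_. 0, {..<R}, 0)] @
    map (\<lambda>r. (2, (\<lambda>_. 0)(r := 1), {}, 2)) [0..<R] @
    map (\<lambda>r. (2, (\<lambda>_. 0)(r := -1), {}, 2)) [0..<R] @
    map (\<lambda>r. (1, (\<lambda>_. 0)(r := -1), {}, 1)) [0..<R] @
    map (\<lambda>p. (2, \<lambda>_. 0, {}, p)) [0..<Q] @
    map (\<lambda>p. (p, \<lambda>_. 0, {}, 1)) [0..<Q]"

text \<open>The input occurs only in the action of the first rule; this allows the rest of the
  instance to be encoded before the input is chosen.\<close>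

definition machine :: "prog \<Rightarrow> nat \<Rightarrow> nat \<Rightarrow> nat list \<Rightarrow> rule list" where
  "machine c R Q cs = (0, \<lambda>r. int (input_store cs r), {}, 3) # other_rules c R Q"

lemma machine_wf:
  assumes "reg_bound c \<le> R" "length cs \<le> R" "\<rho> \<in> set (machine c R (5 + inner_states c) cs)"
  shows "wf_rule R (5 + inner_states c) \<rho>"
proof -
  have "wf_rule R (5 + inner_states c) \<rho>" if "\<rho> \<in> set (rules c 3 4 5)"
  proof -
    obtain p \<delta> Z q where \<rho>: "\<rho> = (p, \<delta>, Z, q)" by (cases \<rho>)
    from rules_states[OF that[unfolded \<rho>]] wf_rules[OF that[unfolded \<rho>]] assms(1) show ?thesis
      by (auto simp: \<rho> wf_rule_def)
  qed
  with assms show ?thesis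
    by (auto simp: machine_def other_rules_def wf_rule_def input_store_def)
qed

text \<open>Each decrement lowers the sum of the first \<open>R\<close> registers.\<close>

lemma steps_to_zero:
  fixes S :: "(nat \<times> store) rel"
  assumes "\<And>r s. r < R \<Longrightarrow> 0 < s r \<Longrightarrow> ((p, s), (p, s(r := s r - 1))) \<in> S" "\<forall>r\<ge>R. s r = 0"
  shows "((p, s), (p, \<lambda>_. 0)) \<in> S\<^sup>*"
  using assms(2)
proof (induction "sum s {..<R}" arbitrary: s rule: less_induct)
  case less
  show ?case
  proof (cases "s = (\<lambda>_. 0)")
    case False
    then obtain r where r: "0 < s r" by auto
    with less.prems have "r < R" by (metis leI less_irrefl)
    with r have "sum (s(r := s r - 1)) {..<R} < sum s {..<R}"
      by (intro sum_strict_mono_ex1) auto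
    then have "((p, s(r := s r - 1)), (p, \<lambda>_. 0)) \<in> S\<^sup>*"
      using less.prems by (intro less.hyps) auto
    with assms(1)[of r s] r \<open>r < R\<close> show ?thesis by (meson converse_rtrancl_into_rtrancl)
  qed simp
qed

text \<open>Increments are decrements of the converse relation.\<close>

lemma steps_from_zero:
  fixes S :: "(nat \<times> store) rel"
  assumes "\<And>r s. r < R \<Longrightarrow> ((p, s), (p, s(r := Suc (s r)))) \<in> S" "\<forall>r\<ge>R. s r = 0"
  shows "((p, \<lambda>_. 0), (p, s)) \<in> S\<^sup>*"
proof -
  have "((p, s), (p, s(r := s r - 1))) \<in> S\<inverse>" if "r < R" "0 < s r" for r s
    using assms(1)[of r "s(r := s r - 1)"] that by simp
  from steps_to_zero[of R p "S\<inverse>" s, OF this assms(2)] show ?thesis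
    by (simp add: rtrancl_converse)
qed

lemma steps_unused_registers:
  assumes "\<And>\<rho>. \<rho> \<in> S \<Longrightarrow> wf_rule R Q \<rho>" "((p, s), (q, t)) \<in> (step S)\<^sup>*" "\<forall>r\<ge>R. s r = 0"
  shows "\<forall>r\<ge>R. t r = 0"
  using assms(2)
proof (induction rule: rtrancl_induct2)
  case (step p' s' q' t')
  then obtain \<delta> Z where "(p', \<delta>, Z, q') \<in> S" and f: "fires \<delta> Z s' t'" by (auto simp: step_def)
  then have "\<forall>r\<ge>R. \<delta> r = 0" using assms(1) by (fastforce simp: wf_rule_def)
  show ?case
  proof (intro allI impI)
    fix r assume "R \<le> r"
    then have "int (t' r) = int (s' r) + 0"
      using f \<open>\<forall>r\<ge>R. \<delta> r = 0\<close> by (simp add: fires_def)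
    with step.IH \<open>R \<le> r\<close> show "t' r = 0" by simp
  qed
qed (fact assms(3))

text \<open>If \<open>c\<close> terminates, state 2 is reachable and leads to every state and store,
  and state 1 leads back from everywhere. If it does not, the rule from 4 to 2 cannot be
  covered.\<close>

lemma machine_in_adherence_iff:
  assumes R: "reg_bound c \<le> R" "length cs \<le> R" and Q: "Q = 5 + inner_states c"
  shows "star_in_adherence (rules_instance R Q (machine c R Q cs)) \<longleftrightarrow>
    (\<exists>t. (input_store cs, t) \<in> sem c)"
proof -
  let ?S = "set (machine c R Q cs)"
  have wf: "wf_rule R Q \<rho>" if "\<rho> \<in> ?S" for \<rho>
    using machine_wf[OF R] that unfolding Q by blast
  interpret counter_system R Q "machine c R Q cs"
    using wf by unfold_locales (auto simp: Q)
  show ?thesis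
  proof
    show "star_in_adherence (rules_instance R Q (machine c R Q cs))"
      if "\<exists>t. (input_store cs, t) \<in> sem c"
    proof (rule in_adherenceI)
      fix p \<delta> Z q s t
      assume rule: "(p, \<delta>, Z, q) \<in> ?S" and f: "fires \<delta> Z s t" and s: "\<forall>r\<ge>R. s r = 0"
      have pq: "p < Q" "q < Q" using wf[OF rule] by (auto simp: wf_rule_def)
      from that obtain u where "(input_store cs, u) \<in> sem c" by blast
      then have "((3, input_store cs), (4, u)) \<in> (step ?S)\<^sup>*"
        by (rule sem_imp_steps) (auto simp: machine_def other_rules_def)
      moreover have "((0, \<lambda>_. 0), (3, input_store cs)) \<in> step ?S"
        by (rule stepI[where Z = "{}"]) (auto simp: machine_def fires_def)
      moreover have "((4, u), (2, u)) \<in> step ?S"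
        by (rule stepI[where Z = "{}" and \<delta> = "\<lambda>_. 0"])
          (auto simp: machine_def other_rules_def fires_zero)
      ultimately have u: "((0, \<lambda>_. 0), (2, u)) \<in> (step ?S)\<^sup>*"
        by (meson converse_rtrancl_into_rtrancl rtrancl.rtrancl_into_rtrancl)
      with wf have "\<forall>r\<ge>R. u r = 0" by (rule steps_unused_registers) auto
      then have "((2, u), (2, \<lambda>_. 0)) \<in> (step ?S)\<^sup>*"
        by (intro steps_to_zero[where R = R] stepI[where Z = "{}" and \<delta> = "(\<lambda>_. 0)(_ := -1)"])
          (auto simp: machine_def other_rules_def fires_dec)
      moreover have "((2, \<lambda>_. 0), (2, s)) \<in> (step ?S)\<^sup>*"
        using s by (intro steps_from_zero[where R = R] stepI[where Z = "{}" and \<delta> = "(\<lambda>_. 0)(_ := 1)"])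
          (auto simp: machine_def other_rules_def fires_inc)
      moreover have "((2, s), (p, s)) \<in> step ?S"
        using pq by (intro stepI[where Z = "{}" and \<delta> = "\<lambda>_. 0"])
          (auto simp: machine_def other_rules_def fires_zero)
      ultimately have "((0, \<lambda>_. 0), (p, s)) \<in> (step ?S)\<^sup>*"
        using u by (meson rtrancl_trans rtrancl.rtrancl_into_rtrancl)
      moreover have t: "\<forall>r\<ge>R. t r = 0"
        using steps_unused_registers[OF wf r_into_rtrancl[OF stepI[OF rule f]] s] .
      have "((q, t), (1, t)) \<in> step ?S"
        using pq by (intro stepI[where Z = "{}" and \<delta> = "\<lambda>_. 0"])
          (auto simp: machine_def other_rules_def fires_zero)
      moreover have "((1, t), (1, \<lambda>_. 0)) \<in> (step ?S)\<^sup>*"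
        using t by (intro steps_to_zero[where R = R] stepI[where Z = "{}" and \<delta> = "(\<lambda>_. 0)(_ := -1)"])
          (auto simp: machine_def other_rules_def fires_dec)
      moreover have "((1, \<lambda>_. 0), (0, \<lambda>_. 0)) \<in> step ?S"
        by (rule stepI[where Z = "{..<R}" and \<delta> = "\<lambda>_. 0"])
          (auto simp: machine_def other_rules_def fires_zero)
      ultimately show "((0, \<lambda>_. 0), (p, s)) \<in> (step ?S)\<^sup>* \<and> ((q, t), (0, \<lambda>_. 0)) \<in> (step ?S)\<^sup>*"
        by (meson converse_rtrancl_into_rtrancl rtrancl.rtrancl_into_rtrancl)
    qed
  next
    assume adh: "star_in_adherence (rules_instance R Q (machine c R Q cs))"
    show "\<exists>t. (input_store cs, t) \<in> sem c"
    proof (rule ccontr)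
      assume no: "\<nexists>t. (input_store cs, t) \<in> sem c"
      \<comment> \<open>Without termination the exit 4, and with it state 2, is never reached. State
        1 may hold any store, states 0 and 3 a single one each.\<close>
      define J :: "nat \<Rightarrow> store set" where
        "J = (\<lambda>_. UNIV)(0 := {\<lambda>_. 0}, 2 := {}, 3 := {input_store cs}, 4 := {})"
      have "sem c `` J 3 \<subseteq> J 4" using no by (auto simp: J_def)
      from invariant_extend[of c J 3 4 5, OF this] obtain J' where
        J': "\<forall>k<5. J' k = J k" and inv: "invariant (set (rules c 3 4 5)) J'" by auto
      have J'_simps: "J' 0 = {\<lambda>_. 0}" "J' 1 = UNIV" "J' (Suc 0) = UNIV" "J' 2 = {}"
          "J' 3 = {input_store cs}" "J' 4 = {}"
        using J' by (auto simp: J_def)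
      \<comment> \<open>The rule from 1 to 0 tests only the registers below \<open>R\<close>; that
        the others are 0 has to be part of the invariant.\<close>
      define J2 where "J2 p = J' p \<inter> {s. \<forall>r\<ge>R. s r = 0}" for p
      have "invariant ?S J2"
        unfolding invariant_def
      proof (intro allI impI)
        fix p \<delta> Z q s t
        assume rule: "(p, \<delta>, Z, q) \<in> ?S" and s: "s \<in> J2 p" and f: "fires \<delta> Z s t"
        have s': "\<forall>r\<ge>R. s r = 0" "s \<in> J' p" using s by (auto simp: J2_def)
        have t: "\<forall>r\<ge>R. t r = 0"
          using steps_unused_registers[OF wf r_into_rtrancl[OF stepI[OF rule f]] s'(1)] .
        have "t \<in> J' q"
        proof (cases "(p, \<delta>, Z, q) \<in> set (rules c 3 4 5)")
          case True
          with inv s'(2) f show ?thesis unfolding invariant_def by blast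
        next
          case False
          \<comment> \<open>States 2 and 4 have no stores and state 1 admits all, so only the
            loading of the input and the return to 0 require an argument.\<close>
          consider "p = 0" "\<delta> = (\<lambda>r. int (input_store cs r))" "q = 3" | "p = 2" | "p = 4" | "q = 1"
            | "p = 1" "\<delta> = (\<lambda>_. 0)" "Z = {..<R}" "q = 0"
            using rule False by (auto simp: machine_def other_rules_def)
          then show ?thesis
          proof cases
            case 1
            then show ?thesis using s'(2) f by (auto simp: J'_simps fires_def)
          next
            case 5
            then have "t = s" "\<forall>r<R. s r = 0" using f by (auto simp: fires_zero)
            with s'(1) have "t = (\<lambda>_. 0)" by (metis leI)
            with 5 show ?thesis by (simp add: J'_simps)
          qed (use s'(2) in \<open>simp_all add: J'_simps\<close>)
        qed
        with t show "t \<in> J2 q" by (simp add: J2_def)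
      qed
      then have "\<not> star_in_adherence (rules_instance R Q (machine c R Q cs))"
        by (rule not_in_adherenceI[where p = 4 and q = 2 and Z = "{}" and \<delta> = "\<lambda>_. 0"])
          (auto simp: J2_def J'_simps machine_def other_rules_def)
      with adh show False by blast
    qed
  qed
qed

section \<open>Diagonalization\<close>

definition rec_add :: recf where
  "rec_add = PrimRec (Proj 0) (Comp Succ [Proj 1])"

definition rec_triangle :: recf where
  "rec_triangle = PrimRec Zero (Comp Succ [Comp rec_add [Proj 0, Proj 1]])"

text \<open>Doubling is the code of a natural number as an integer and, followed by
  \<open>Succ\<close>, that of a right summand.\<close>

definition rec_double :: "recf \<Rightarrow> recf" where
  "rec_double f = Comp rec_add [f, f]"

text \<open>The Cantor pairing function behind \<open>prod_encode\<close>.\<close>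

definition rec_pair :: "recf \<Rightarrow> recf \<Rightarrow> recf" where
  "rec_pair f g = Comp rec_add [Comp rec_triangle [Comp rec_add [f, g]], f]"

definition rec_cons :: "recf \<Rightarrow> recf \<Rightarrow> recf" where
  "rec_cons f g = Comp Succ [rec_pair f g]"

lemma rec_eval_Comp1:
  "rec_eval g xs m \<Longrightarrow> rec_eval f [m] z \<Longrightarrow> rec_eval (Comp f [g]) xs z"
  by (auto simp: rec_eval_Comp_iff intro!: exI[of _ "[m]"])

lemma rec_eval_Comp2:
  "rec_eval g xs m \<Longrightarrow> rec_eval h xs n \<Longrightarrow> rec_eval f [m, n] z \<Longrightarrow> rec_eval (Comp f [g, h]) xs z"
  by (auto simp: rec_eval_Comp_iff intro!: exI[of _ "[m, n]"])

lemma rec_eval_Succ: "rec_eval g xs m \<Longrightarrow> rec_eval (Comp Succ [g]) xs (Suc m)"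
  by (auto intro: rec_eval_Comp1 eval_Succ)

lemma rec_eval_Proj: "i < length xs \<Longrightarrow> y = xs ! i \<Longrightarrow> rec_eval (Proj i) xs y"
  by (simp add: eval_Proj)

lemma rec_eval_add: "rec_eval rec_add [m, n] (m + n)"
proof (induction m)
  case 0
  show ?case by (auto simp: rec_add_def rec_eval_PrimRec_0_iff intro: rec_eval_Proj)
next
  case (Suc m)
  then show ?case
    by (auto simp: rec_add_def rec_eval_PrimRec_Suc_iff
      intro!: exI[of _ "m + n"] rec_eval_Succ rec_eval_Proj)
qed

lemma rec_eval_triangle: "rec_eval rec_triangle [n] (triangle n)"
proof (induction n)
  case 0
  show ?case by (auto simp: rec_triangle_def rec_eval_PrimRec_0_iff intro: eval_Zero)
next
  case (Suc n)
  have "rec_eval (Comp Succ [Comp rec_add [Proj 0, Proj 1]]) [n, triangle n] (Suc (n + triangle n))"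
    by (intro rec_eval_Succ rec_eval_Comp2[OF _ _ rec_eval_add] rec_eval_Proj) auto
  with Suc show ?case
    by (auto simp: rec_triangle_def rec_eval_PrimRec_Suc_iff add.commute)
qed

lemma rec_eval_double: "rec_eval f xs m \<Longrightarrow> rec_eval (rec_double f) xs (2 * m)"
  unfolding rec_double_def mult_2 by (rule rec_eval_Comp2[OF _ _ rec_eval_add])

lemma rec_eval_pair:
  "rec_eval f xs m \<Longrightarrow> rec_eval g xs n \<Longrightarrow> rec_eval (rec_pair f g) xs (prod_encode (m, n))"
  unfolding rec_pair_def prod_encode_def prod.case
  by (intro rec_eval_Comp2[OF _ _ rec_eval_add] rec_eval_Comp1[OF _ rec_eval_triangle])

lemma rec_eval_cons:
  "rec_eval f xs m \<Longrightarrow> rec_eval g xs (list_encode l) \<Longrightarrow>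
    rec_eval (rec_cons f g) xs (list_encode (m # l))"
  unfolding rec_cons_def list_encode.simps by (intro rec_eval_Succ rec_eval_pair)

section \<open>From star sets to ideals\<close>

definition star_to_ideal :: "star_instance \<Rightarrow> ideal_instance" where
  "star_to_ideal = (\<lambda>(d, as, x, ts). (d, as, x, x, (map enat x, [Star ts], map enat x)))"

lemma below_map_enat: "below (map enat x) = {u. vec_le u x}"
  by (auto simp: below_def vec_le_def list_all2_conv_all_nth)

text \<open>The star set is presented by a single \<open>Star\<close> atom and the bound
  \<open>x\<close> at both ends. It is directed because words over \<open>D\<close> can be
  concatenated.\<close>

lemma star_to_ideal:
  assumes "i \<in> star_instances"
  shows "star_to_ideal i \<in> ideal_instances"
    and "ideal_in_adherence (star_to_ideal i) \<longleftrightarrow> star_in_adherence i"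
proof -
  obtain d as x ts where i: "i = (d, as, x, ts)" by (cases i)
  let ?A = "set as" and ?D = "otriples_set ts" and ?J = "(map enat x, [Star ts], map enat x)"
  have *: "vas d ?A" "length x = d" "\<And>t. t \<in> set ts \<Longrightarrow> wf_otriple d ?A t"
    "down_closed_transition_set d ?A ?D"
    using assms by (auto simp: i star_instances_def configs_def)
  have D: "down_closed_in triple_le (triples d ?A) ?D"
    by (rule down_closed_transition_set_imp_down_closed) fact
  then have "lists ?D \<subseteq> lists (triples d ?A)" by (auto simp: down_closed_in_def)
  then have ideal: "ideal_of ?J = star_preruns d ?A x ?D"
    using *(2) by (auto simp: below_map_enat star_preruns_def preruns_def configs_def vec_le_def
      dest: list_all2_lengthD)
  show "ideal_in_adherence (star_to_ideal i) \<longleftrightarrow> star_in_adherence i"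
    by (simp add: i star_to_ideal_def ideal del: ideal_of.simps)
  have "ideal_in prerun_le (preruns d ?A) (star_preruns d ?A x ?D)"
    unfolding ideal_in_def
  proof (intro conjI)
    have "(x, [], x) \<in> star_preruns d ?A x ?D"
      using *(2) by (simp add: star_preruns_def preruns_def configs_def vec_le_refl)
    then show "star_preruns d ?A x ?D \<noteq> {}" by blast
    show "down_closed_in prerun_le (preruns d ?A) (star_preruns d ?A x ?D)"
      unfolding down_closed_in_def
    proof (intro conjI ballI impI)
      fix r s assume s: "s \<in> star_preruns d ?A x ?D" and r: "r \<in> preruns d ?A" "prerun_le r s"
      obtain u w v u' w' v' where rs: "r = (u, w, v)" "s = (u', w', v')" by (cases r; cases s)
      have "w \<in> lists ?D"
        using s r by (intro lists_down_closed[OF D, of w w']) (auto simp: rs star_preruns_def preruns_def)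
      then show "r \<in> star_preruns d ?A x ?D"
        using s r by (auto simp: rs star_preruns_def intro: vec_le_trans)
    qed (auto simp: star_preruns_def)
    show "directed_set prerun_le (star_preruns d ?A x ?D)"
      unfolding directed_set_def
    proof (intro ballI)
      fix r s assume rs: "r \<in> star_preruns d ?A x ?D" "s \<in> star_preruns d ?A x ?D"
      obtain u w v u' w' v' where r: "r = (u, w, v)" and s: "s = (u', w', v')" by (cases r; cases s)
      have emb: "list_emb triple_le w w" "list_emb triple_le w' w'"
        by (simp_all add: list_emb_refl triple_le_refl del: triple_le.simps)
      have "list_emb triple_le w (w @ w')" using emb(1) by (rule list_emb_prefix)
      moreover have "list_emb triple_le w' (w @ w')" using emb(2) by (rule list_emb_append2)
      moreover have "(x, w @ w', x) \<in> star_preruns d ?A x ?D"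
        using rs *(2) by (auto simp: r s star_preruns_def preruns_def configs_def vec_le_refl)
      ultimately show "\<exists>t\<in>star_preruns d ?A x ?D. prerun_le r t \<and> prerun_le s t"
        using rs by (intro bexI[of _ "(x, w @ w', x)"]) (auto simp: r s star_preruns_def)
    qed
  qed
  with * ideal show "star_to_ideal i \<in> ideal_instances"
    by (simp add: i star_to_ideal_def ideal_instances_def configs_def del: ideal_of.simps)
qed

text \<open>
  Argument 0 is the dummy argument of the minimisation in the diagonal function. Arguments 1 to 8 are
  the dimension and the codes of the parts of the instance that do not depend on the input: the tail
  of the first action, the other actions, the initial configuration, the two bounds of the first
  triple, the other triples, and the initial configuration as an upper bound.
\<close>

definition rec_action :: recf where
  "rec_action = foldr (\<lambda>k. rec_cons (rec_double (Proj (Suc k)))) [0..<8] (Proj 2)"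

definition rec_actions :: recf where
  "rec_actions = rec_cons rec_action (Proj 3)"

definition rec_triples :: recf where
  "rec_triples = rec_cons (rec_pair (Proj 5) (rec_pair rec_action (Proj 6))) (Proj 7)"

definition rec_star_instance :: recf where
  "rec_star_instance = rec_pair (Proj 1) (rec_pair rec_actions (rec_pair (Proj 4) rec_triples))"

text \<open>\<open>Comp Succ [rec_double _]\<close> produces the code of the \<open>Star\<close>
  atom, \<open>Zero\<close> that of the empty list behind it. \<open>Proj 4\<close> occurs twice
  because both end configurations are \<open>x\<close>.\<close>

definition rec_ideal_instance :: recf where
  "rec_ideal_instance = rec_pair (Proj 1) (rec_pair rec_actions (rec_pair (Proj 4) (rec_pair (Proj 4)
    (rec_pair (Proj 8) (rec_pair (rec_cons (Comp Succ [rec_double rec_triples]) Zero) (Proj 8))))))"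

text \<open>The leading entries of the first action are the input numbers themselves, so their codes
  arise from the arguments by doubling.\<close>

lemma rec_eval_foldr_cons:
  assumes "rec_eval e xs (list_encode l)" "set ks \<subseteq> {k. Suc k < length xs}"
  shows "rec_eval (foldr (\<lambda>k. rec_cons (rec_double (Proj (Suc k)))) ks e) xs
    (list_encode (map (\<lambda>k. int_encode (int (xs ! Suc k))) ks @ l))"
  using assms(2)
proof (induction ks)
  case (Cons k ks)
  have "int_encode (int n) = 2 * n" for n by (simp add: int_encode_def sum_encode_def)
  with Cons show ?case
    by (auto intro!: rec_eval_cons rec_eval_double rec_eval_Proj simp del: list_encode.simps)
qed (use assms(1) in simp)

text \<open>Recursion theorem in disguise: the input of the machine is the description of the machine.\<close>

lemma instance_for_recf:
  obtains cs i where "i \<in> star_instances" "star_in_adherence i \<longleftrightarrow> (\<exists>y. rec_eval G cs y)"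
    "\<And>n. rec_eval rec_star_instance (n # cs) (star_instance_encode i)"
    "\<And>n. rec_eval rec_ideal_instance (n # cs) (ideal_instance_encode (star_to_ideal i))"
proof -
  \<comment> \<open>Registers 0 to 7 hold the input, register 8 the result, and scratch space starts
    at 9.\<close>
  define c where "c = compile G [0..<8] 8 9"
  define R where "R = max 9 (reg_bound c)"
  define Q where "Q = 5 + inner_states c"
  define rls where "rls = other_rules c R Q"
  define as where "as = map (rule_action R Q) rls"
  define ts where "ts = map (rule_otriple R Q) rls"
  define x where "x = cfg R Q 0 (\<lambda>_. 0)"
  \<comment> \<open>The entries of the first action behind the input: 0 on the remaining registers,
    then the change of control from state 0 to state 3.\<close>
  define tl where "tl = map (\<lambda>i. if i < R then 0 else of_bool (i = R + 3) - of_bool (i = R + 0) :: int)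
    [8..<R + Q]"
  \<comment> \<open>No entry depends on the action that loads \<open>cs\<close>, so the definition
    is not circular.\<close>
  define cs where "cs = [R + Q, action_encode tl, actions_encode as, config_encode x,
    ovec_encode (guard R Q {} 0), ovec_encode (guard R Q {} 3), otriples_encode ts,
    ovec_encode (map enat x)]"
  define i where "i = rules_instance R Q (machine c R Q cs)"
  define a where "a = map int cs @ tl"
  have len: "length cs = 8" by (simp add: cs_def)
  have R: "reg_bound c \<le> R" "length cs \<le> R" by (auto simp: R_def len)
  interpret counter_system R Q "machine c R Q cs"
    using machine_wf[OF R] by unfold_locales (auto simp: Q_def)
  have "rule_action R Q (0, \<lambda>r. int (input_store cs r), {}, 3) = a"
  proof -
    have "[0..<R + Q] = [0..<8] @ [8..<R + Q]"
      using upt_add_eq_append[of 0 8 "R + Q - 8"] by (simp add: R_def)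
    moreover have "map (\<lambda>i. if i < R then int (input_store cs i)
        else of_bool (i = R + 3) - of_bool (i = R + 0)) [0..<8] = map int cs"
      using len R by (intro nth_equalityI) (auto simp: input_store_def)
    moreover have "map (\<lambda>i. if i < R then int (input_store cs i)
        else of_bool (i = R + 3) - of_bool (i = R + 0)) [8..<R + Q] = tl"
      unfolding tl_def using len by (intro map_cong) (auto simp: input_store_def)
    ultimately show ?thesis unfolding rule_action_def prod.case a_def by (simp only: map_append)
  qed
  then have i: "i = (R + Q, a # as, x, (guard R Q {} 0, a, guard R Q {} 3) # ts)"
    by (simp add: i_def rules_instance_def machine_def rls_def[symmetric] as_def ts_def x_def
      rule_otriple_def)
  have act: "rec_eval rec_action (n # cs) (action_encode a)" for n
  proof -
    have "map (\<lambda>k. int_encode (int ((n # cs) ! Suc k))) [0..<8] = map int_encode (map int cs)"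
      using len by (intro nth_equalityI) auto
    moreover have "rec_eval (Proj 2) (n # cs) (list_encode (map int_encode tl))"
      by (intro rec_eval_Proj) (auto simp: cs_def action_encode_def)
    moreover have "set [0..<8] \<subseteq> {k. Suc k < length (n # cs)}" using len by auto
    ultimately show ?thesis
      using rec_eval_foldr_cons[of "Proj 2" "n # cs" "map int_encode tl" "[0..<8]"]
      unfolding rec_action_def a_def action_encode_def map_append by simp
  qed
  have acts: "rec_eval rec_actions (n # cs) (actions_encode (a # as))" for n
    unfolding rec_actions_def actions_encode_def list.map
    by (intro rec_eval_cons act rec_eval_Proj) (auto simp: cs_def actions_encode_def)
  have trs: "rec_eval rec_triples (n # cs)
      (otriples_encode ((guard R Q {} 0, a, guard R Q {} 3) # ts))" for n
    unfolding rec_triples_def otriples_encode_def list.map otriple_encode.simps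
    by (intro rec_eval_cons rec_eval_pair act rec_eval_Proj) (auto simp: cs_def otriples_encode_def)
  have "rec_eval rec_star_instance (n # cs) (star_instance_encode i)" for n
    unfolding rec_star_instance_def i star_instance_encode.simps
    by (intro rec_eval_pair acts trs rec_eval_Proj) (auto simp: cs_def)
  moreover have "rec_eval rec_ideal_instance (n # cs) (ideal_instance_encode (star_to_ideal i))" for n
  proof -
    have "rec_eval (rec_cons (Comp Succ [rec_double rec_triples]) Zero) (n # cs)
      (list_encode (map atom_encode [Star ((guard R Q {} 0, a, guard R Q {} 3) # ts)]))"
      unfolding list.map atom_encode.simps sum_encode_def sum.case
      by (intro rec_eval_cons rec_eval_Succ rec_eval_double trs) (auto intro: eval_Zero)
    then show ?thesis
      unfolding rec_ideal_instance_def i star_to_ideal_def prod.case ideal_instance_encode.simps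
        ideal_rep_encode.simps
      by (intro rec_eval_pair acts rec_eval_Proj) (auto simp: cs_def)
  qed
  moreover have "star_in_adherence i \<longleftrightarrow> (\<exists>y. rec_eval G cs y)"
  proof -
    have "map (input_store cs) [0..<8] = cs"
      using len by (intro nth_equalityI) (auto simp: input_store_def)
    then have "(\<exists>t. (input_store cs, t) \<in> sem c) \<longleftrightarrow> (\<exists>y. rec_eval G cs y)"
      unfolding c_def by (subst computesD[OF computes]) (auto simp: input_store_def len)
    then show ?thesis
      unfolding i_def using machine_in_adherence_iff[OF R Q_def] by simp
  qed
  moreover have "i \<in> star_instances" unfolding i_def by (rule rules_instance_valid)
  ultimately show thesis using that by blast
qed

text \<open>\<open>S\<close> ignores the minimised argument, so the minimisation halts, with value
  0, iff \<open>f\<close> answers 0 on \<open>e\<close>, that is, iff \<open>P\<close>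
  fails.\<close>

lemma diagonal_contradiction:
  assumes S: "\<And>n. rec_eval S (n # cs) e" and f: "rec_eval f [e] (if P then 1 else 0)"
    and P: "P \<longleftrightarrow> (\<exists>y. rec_eval (Mu (Comp f [S])) cs y)"
  shows False
proof -
  have ev: "rec_eval (Comp f [S]) (n # cs) (if P then 1 else 0)" for n
    using S f by (rule rec_eval_Comp1)
  show False
  proof (cases P)
    case True
    with P obtain y where "rec_eval (Comp f [S]) (y # cs) 0" by (auto simp: rec_eval_Mu_iff)
    with ev[of y] True show False by (auto dest: rec_eval_deterministic)
  next
    case False
    with ev[of 0] have "rec_eval (Mu (Comp f [S])) cs 0" by (simp add: rec_eval_Mu_iff)
    with False P show False by blast
  qed
qed

theorem theorem5p3:
  "\<not> decidable_problem star_instance_encode star_instances star_in_adherence \<and>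
   \<not> decidable_problem ideal_instance_encode ideal_instances ideal_in_adherence"
proof (intro conjI notI)
  assume "decidable_problem star_instance_encode star_instances star_in_adherence"
  then obtain f where f: "\<And>i. i \<in> star_instances \<Longrightarrow>
      rec_eval f [star_instance_encode i] (if star_in_adherence i then 1 else 0)"
    unfolding decidable_problem_def by blast
  \<comment> \<open>\<open>?G\<close> halts on the description of an instance iff \<open>f\<close>
    rejects that instance.\<close>
  let ?G = "Mu (Comp f [rec_star_instance])"
  obtain cs i where i: "i \<in> star_instances" "star_in_adherence i \<longleftrightarrow> (\<exists>y. rec_eval ?G cs y)"
      "\<And>n. rec_eval rec_star_instance (n # cs) (star_instance_encode i)"
    by (rule instance_for_recf[of ?G]) (rule that)
  show False by (rule diagonal_contradiction[OF i(3) f[OF i(1)] i(2)])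
next
  assume "decidable_problem ideal_instance_encode ideal_instances ideal_in_adherence"
  then obtain f where f: "\<And>i. i \<in> ideal_instances \<Longrightarrow>
      rec_eval f [ideal_instance_encode i] (if ideal_in_adherence i then 1 else 0)"
    unfolding decidable_problem_def by blast
  let ?G = "Mu (Comp f [rec_ideal_instance])"
  obtain cs i where i: "i \<in> star_instances" "star_in_adherence i \<longleftrightarrow> (\<exists>y. rec_eval ?G cs y)"
      "\<And>n. rec_eval rec_ideal_instance (n # cs) (ideal_instance_encode (star_to_ideal i))"
    by (rule instance_for_recf[of ?G]) (rule that)
  from f[OF star_to_ideal(1)[OF i(1)]] have
    "rec_eval f [ideal_instance_encode (star_to_ideal i)] (if star_in_adherence i then 1 else 0)"
    unfolding star_to_ideal(2)[OF i(1)] .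
  then show False by (rule diagonal_contradiction[OF i(3) _ i(2)])
qed

end
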